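(* Let $\gamma:I\to\mathbb{R}^3$ be a smooth non-degenerate curve and let $1<p<\infty$. If $-1\le\alpha\le p-1$, then for every $t>0$ the operator $A_t$ is bounded from $L^p(|x|^{\alpha})$ to itself.
   Context: Let $I\subset\mathbb{R}$ be an interval. A smooth curve $\gamma:I\to\mathbb{R}^3$ is called non-degenerate if there is a constant $c_0>0$ such that $|\det(\gamma'(s),\gamma''(s),\gamma'''(s))|\ge c_0$ for all $s\in I$. Let $\chi$ be a bump function (smooth, nonnegative, not identically zero) supported in the interior of $I$. For $t>0$ put $$A_tf(x)=\int_I f(x-t\gamma(s))\,\chi(s)\,ds.$$ The space $L^p(|x|^{\alpha})$ on $\mathbb{R}^3$ has norm $\|f\|_{L^p(|x|^\alpha)}=\big(\int_{\mathbb{R}^3}|f(x)|^p|x|^{\alpha}dx\big)^{1/p}$. An operator $T$ is bounded from $L^p(|x|^\alpha)$ to itself if there is a constant $C$ with $\|Tf\|_{L^p(|x|^\alpha)}\le C\|f\|_{L^p(|x|^\alpha)}$ for all $f\in L^p(|x|^\alpha)$. *)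

theory Defs
  imports "HOL-Analysis.Analysis"
begin

text \<open>Derivatives on \<open>I\<close> are taken within \<open>I\<close>, hence one-sided at those end points of the
  interval which belong to \<open>I\<close>.\<close>

primrec nth_deriv_within :: "real set \<Rightarrow> nat \<Rightarrow> (real \<Rightarrow> 'a::real_normed_vector) \<Rightarrow> real \<Rightarrow> 'a" where
  "nth_deriv_within I 0 g = g"
| "nth_deriv_within I (Suc k) g =
     (\<lambda>s. vector_derivative (nth_deriv_within I k g) (at s within I))"

definition smooth_on :: "real set \<Rightarrow> (real \<Rightarrow> 'a::real_normed_vector) \<Rightarrow> bool" where
  "smooth_on I g \<longleftrightarrow> (\<forall>k. nth_deriv_within I k g differentiable_on I)"

definition nondegenerate_on :: "real set \<Rightarrow> (real \<Rightarrow> real ^ 3) \<Rightarrow> bool" where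
  "nondegenerate_on I \<gamma> \<longleftrightarrow>
     (\<exists>c\<^sub>0>0. \<forall>s\<in>I.
        \<bar>det (vector [nth_deriv_within I 1 \<gamma> s,
                      nth_deriv_within I 2 \<gamma> s,
                      nth_deriv_within I 3 \<gamma> s] :: real ^ 3 ^ 3)\<bar> \<ge> c\<^sub>0)"

definition bump_function_in :: "real set \<Rightarrow> (real \<Rightarrow> real) \<Rightarrow> bool" where
  "bump_function_in U chi \<longleftrightarrow>
     smooth_on UNIV chi \<and> (\<forall>s. chi s \<ge> 0) \<and> (\<exists>s. chi s \<noteq> 0) \<and>
     compact (closure {s. chi s \<noteq> 0}) \<and> closure {s. chi s \<noteq> 0} \<subseteq> U"

text \<open>The Bochner integral is \<open>0\<close> where the integrand is not integrable; integrability for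
  almost every \<open>x\<close> therefore has to be asserted separately.  Lebesgue rather than Borel
  measurability is used in \<open>s\<close> because \<open>f\<close> is only Lebesgue measurable.\<close>

definition averaging_integrand ::
  "(real \<Rightarrow> real ^ 3) \<Rightarrow> (real \<Rightarrow> real) \<Rightarrow> real \<Rightarrow> (real ^ 3 \<Rightarrow> complex) \<Rightarrow> real ^ 3 \<Rightarrow> real \<Rightarrow> complex" where
  "averaging_integrand \<gamma> chi t f x s = f (x - t *\<^sub>R \<gamma> s) * of_real (chi s)"

definition averaging ::
  "real set \<Rightarrow> (real \<Rightarrow> real ^ 3) \<Rightarrow> (real \<Rightarrow> real) \<Rightarrow> real \<Rightarrow> (real ^ 3 \<Rightarrow> complex) \<Rightarrow> real ^ 3 \<Rightarrow> complex" where
  "averaging I \<gamma> chi t f x = (LINT s:I|lebesgue. averaging_integrand \<gamma> chi t f x s)"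

text \<open>The weighted space consists of functions rather than of classes modulo null sets.  The
  convention \<open>0 powr \<alpha> = 0\<close> affects the weight only at the origin, which is a null set.\<close>

definition weighted_Lp :: "real \<Rightarrow> real \<Rightarrow> (real ^ 3 \<Rightarrow> complex) set" where
  "weighted_Lp p \<alpha> =
     {f. f \<in> borel_measurable lebesgue \<and>
         integrable lebesgue (\<lambda>x. norm (f x) powr p * norm x powr \<alpha>)}"

definition weighted_Lp_norm :: "real \<Rightarrow> real \<Rightarrow> (real ^ 3 \<Rightarrow> complex) \<Rightarrow> real" where
  "weighted_Lp_norm p \<alpha> f =
     (LINT x|lebesgue. norm (f x) powr p * norm x powr \<alpha>) powr (1 / p)"

definition bounded_on_weighted_Lp ::
  "real \<Rightarrow> real \<Rightarrow> ((real ^ 3 \<Rightarrow> complex) \<Rightarrow> real ^ 3 \<Rightarrow> complex) \<Rightarrow> bool" where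
  "bounded_on_weighted_Lp p \<alpha> T \<longleftrightarrow>
     (\<exists>C. \<forall>f\<in>weighted_Lp p \<alpha>.
        T f \<in> weighted_Lp p \<alpha> \<and> weighted_Lp_norm p \<alpha> (T f) \<le> C * weighted_Lp_norm p \<alpha> f)"

end

theory Submission
  imports Defs
begin

text \<open>
  Only the linear independence of \<open>\<gamma>'\<close> and \<open>\<gamma>''\<close> matters.  Put \<open>\<eta> = t \<gamma>\<close> and cut the support of
  \<open>chi\<close> into finitely many short intervals \<open>J\<close>.  On each of them Schur's test with two weights
  \<open>W\<close> and \<open>V\<close> applies.  For \<open>-1 < \<alpha> < p - 1\<close> powers of \<open>|x|\<close> suffice as weights, but at both end
  points this fails logarithmically.  There one uses powers of the distance \<open>\<rho>\<close> to the arc \<open>\<eta> ` J\<close>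
  in addition: by curvature, a chord of the arc determines its end points quantitatively, so that
  \<open>\<rho> (x + \<eta> s) \<ge> k |x| |s - s0|\<close> for some \<open>s0\<close> depending on \<open>x\<close>.
\<close>

section \<open>Schur's test with two weights\<close>

lemma ennreal_linear_combination:
  assumes "0 \<le> a" "0 \<le> b" "0 \<le> x" "0 \<le> y"
  shows "ennreal (a * x + b * y) = ennreal a * ennreal x + ennreal b * ennreal y"
  using assms by (simp add: ennreal_mult)

lemma nn_integral_weighted_Holder:
  fixes u w :: "'a \<Rightarrow> real"
  assumes [measurable]: "u \<in> borel_measurable M" "w \<in> borel_measurable M"
    and u: "\<And>s. 0 \<le> u s" and w: "AE s in M. 0 < w s"
    and p: "1 < p" and B: "0 \<le> B" and H: "0 < H"
    and uB: "(\<integral>\<^sup>+s. ennreal (u s powr p * w s) \<partial>M) \<le> ennreal B"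
    and wH: "(\<integral>\<^sup>+s. ennreal (w s powr (-1 / (p - 1))) \<partial>M) \<le> ennreal H"
  shows "(\<integral>\<^sup>+s. ennreal (u s) \<partial>M) \<le> ennreal (B powr (1 / p) * H powr ((p - 1) / p))"
proof (cases "B = 0")
  case True
  with uB have "AE s in M. ennreal (u s powr p * w s) = 0"
    by (subst nn_integral_0_iff_AE[symmetric]) auto
  with w have "AE s in M. ennreal (u s) = 0"
    by eventually_elim (use u in \<open>auto simp: ennreal_eq_0_iff mult_le_0_iff\<close>)
  then have "(\<integral>\<^sup>+s. ennreal (u s) \<partial>M) = 0"
    by (subst nn_integral_0_iff_AE) auto
  then show ?thesis by simp
next
  case False
  with B have B: "0 < B" by simp
  define K where "K = B powr (1 / p) * H powr ((p - 1) / p)"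
  have K: "K > 0" using B H by (simp add: K_def)
  have "AE s in M. u s \<le> K / (p * B) * (u s powr p * w s) + K * (p - 1) / (p * H) * w s powr (-1 / (p - 1))"
    using w
  proof eventually_elim
    case (elim s)
    show ?case
    proof (cases "u s = 0")
      case True
      then show ?thesis using K p H by simp
    next
      case False
      with u[of s] have us: "0 < u s" by simp
      have "(u s powr p * w s / B) powr (1/p) * (w s powr (-1/(p-1)) / H) powr ((p-1)/p)
        \<le> 1/p * (u s powr p * w s / B) + (p-1)/p * (w s powr (-1/(p-1)) / H)"
        by (rule Youngs_inequality_0) (use p us elim B H in \<open>auto simp: field_simps\<close>)
      moreover have "(u s powr p * w s / B) powr (1/p) * (w s powr (-1/(p-1)) / H) powr ((p-1)/p)
        = u s * (w s powr (1/p) * w s powr (-1/p)) / K"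
        using p us elim B H by (simp add: powr_divide powr_mult powr_powr K_def)
      moreover have "w s powr (1/p) * w s powr (-1/p) = 1"
        using elim by (simp flip: powr_add)
      ultimately have "u s / K \<le> 1/p * (u s powr p * w s / B) + (p-1)/p * (w s powr (-1/(p-1)) / H)"
        by simp
      then have "u s \<le> K * (1/p * (u s powr p * w s / B) + (p-1)/p * (w s powr (-1/(p-1)) / H))"
        using K by (simp add: field_simps)
      then show ?thesis by (simp add: algebra_simps)
    qed
  qed
  then have "AE s in M. ennreal (u s) \<le> ennreal (K / (p * B)) * ennreal (u s powr p * w s)
      + ennreal (K * (p - 1) / (p * H)) * ennreal (w s powr (-1 / (p - 1)))"
    using w
  proof eventually_elim
    case (elim s)
    then show ?case using K p B H
      by (subst ennreal_linear_combination[symmetric]) (auto simp del: times_divide_eq_left ennreal_plus intro!: ennreal_leI)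
  qed
  then have "(\<integral>\<^sup>+s. ennreal (u s) \<partial>M) \<le> (\<integral>\<^sup>+s. ennreal (K / (p * B)) * ennreal (u s powr p * w s)
      + ennreal (K * (p - 1) / (p * H)) * ennreal (w s powr (-1 / (p - 1))) \<partial>M)"
    by (rule nn_integral_mono_AE)
  also have "\<dots> = ennreal (K / (p * B)) * (\<integral>\<^sup>+s. ennreal (u s powr p * w s) \<partial>M)
      + ennreal (K * (p - 1) / (p * H)) * (\<integral>\<^sup>+s. ennreal (w s powr (-1 / (p - 1))) \<partial>M)"
    by (subst nn_integral_add) (auto simp: nn_integral_cmult)
  also have "\<dots> \<le> ennreal (K / (p * B)) * ennreal B + ennreal (K * (p - 1) / (p * H)) * ennreal H"
    by (intro add_mono mult_left_mono uB wH) auto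
  also have "\<dots> = ennreal (K / (p * B) * B + K * (p - 1) / (p * H) * H)"
    using K p B H by (subst ennreal_linear_combination) auto
  also have "K / (p * B) * B + K * (p - 1) / (p * H) * H = K"
    using p B H by (simp add: field_simps)
  finally show ?thesis by (simp add: K_def)
qed

lemma nn_integral_lborel_translate:
  fixes f :: "'a::euclidean_space \<Rightarrow> ennreal"
  assumes [measurable]: "f \<in> borel_measurable borel"
  shows "(\<integral>\<^sup>+x. f (x - c) \<partial>lborel) = (\<integral>\<^sup>+y. f y \<partial>lborel)"
proof -
  have "(\<integral>\<^sup>+y. f y \<partial>lborel) = (\<integral>\<^sup>+y. f y \<partial>distr lborel borel ((+) (- c)))"
    by (simp only: lborel_distr_plus)
  also have "\<dots> = (\<integral>\<^sup>+x. f (x - c) \<partial>lborel)"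
    by (subst nn_integral_distr) auto
  finally show ?thesis by simp
qed

lemma schur_test:
  fixes \<mu> :: "'b measure" and \<eta> :: "'b \<Rightarrow> 'a::euclidean_space"
    and W V \<omega> g :: "'a \<Rightarrow> real"
  assumes "sigma_finite_measure \<mu>"
    and [measurable]: "\<eta> \<in> borel_measurable \<mu>" "W \<in> borel_measurable borel"
      "V \<in> borel_measurable borel" "\<omega> \<in> borel_measurable borel" "g \<in> borel_measurable borel"
    and W: "\<And>x. 0 \<le> W x" and V: "\<And>x. 0 \<le> V x" and \<omega>: "\<And>x. 0 \<le> \<omega> x" and g: "\<And>x. 0 \<le> g x"
    and p: "1 < p" and C1: "0 < C1" and C2: "0 \<le> C2"
    and pos: "AE x in lborel. 0 < V x \<and> 0 < \<omega> x \<and> (AE s in \<mu>. 0 < W (x - \<eta> s))"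
    and dual: "AE x in lborel. (\<integral>\<^sup>+s. ennreal (W (x - \<eta> s) powr (-1 / (p - 1))) \<partial>\<mu>)
      \<le> ennreal (C1 * (V x / \<omega> x) powr (1 / (p - 1)))"
    and primal: "AE y in lborel. ennreal (W y) * (\<integral>\<^sup>+s. ennreal (V (y + \<eta> s)) \<partial>\<mu>) \<le> ennreal (C2 * \<omega> y)"
    and fin: "(\<integral>\<^sup>+y. ennreal (g y powr p * \<omega> y) \<partial>lborel) < \<infinity>"
  obtains G where "G \<in> borel_measurable borel" "\<And>x. 0 \<le> G x"
    "AE x in lborel. (\<integral>\<^sup>+s. ennreal (g (x - \<eta> s)) \<partial>\<mu>) \<le> ennreal (G x)"
    "(\<integral>\<^sup>+x. ennreal (G x powr p * \<omega> x) \<partial>lborel)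
      \<le> ennreal (C1 powr (p - 1) * C2) * (\<integral>\<^sup>+y. ennreal (g y powr p * \<omega> y) \<partial>lborel)"
proof -
  interpret \<mu>: sigma_finite_measure \<mu> by fact
  interpret pair_sigma_finite \<mu> "lborel :: 'a measure" ..
  define b where "b x = (\<integral>\<^sup>+s. ennreal (g (x - \<eta> s) powr p * W (x - \<eta> s)) \<partial>\<mu>)" for x
  have [measurable]: "b \<in> borel_measurable borel" unfolding b_def by measurable
  define G where "G x = enn2real (b x) powr (1/p) * (C1 * (V x / \<omega> x) powr (1/(p-1))) powr ((p-1)/p)" for x
  have "(\<integral>\<^sup>+x. ennreal (V x) * b x \<partial>lborel)
    = (\<integral>\<^sup>+x. \<integral>\<^sup>+s. ennreal (V x) * ennreal (g (x - \<eta> s) powr p * W (x - \<eta> s)) \<partial>\<mu> \<partial>lborel)"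
    by (simp add: b_def nn_integral_cmult)
  also have "\<dots> = (\<integral>\<^sup>+s. \<integral>\<^sup>+x. ennreal (V x) * ennreal (g (x - \<eta> s) powr p * W (x - \<eta> s)) \<partial>lborel \<partial>\<mu>)"
    by (rule Fubini') measurable
  also have "\<dots> = (\<integral>\<^sup>+s. \<integral>\<^sup>+y. ennreal (V (y + \<eta> s)) * ennreal (g y powr p * W y) \<partial>lborel \<partial>\<mu>)"
  proof (rule nn_integral_cong)
    fix s
    show "(\<integral>\<^sup>+x. ennreal (V x) * ennreal (g (x - \<eta> s) powr p * W (x - \<eta> s)) \<partial>lborel)
      = (\<integral>\<^sup>+y. ennreal (V (y + \<eta> s)) * ennreal (g y powr p * W y) \<partial>lborel)"
      using nn_integral_lborel_translate[of "\<lambda>y. ennreal (V (y + \<eta> s)) * ennreal (g y powr p * W y)" "\<eta> s"]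
      by simp
  qed
  also have "\<dots> = (\<integral>\<^sup>+y. \<integral>\<^sup>+s. ennreal (V (y + \<eta> s)) * ennreal (g y powr p * W y) \<partial>\<mu> \<partial>lborel)"
    by (rule Fubini'[symmetric]) measurable
  also have "\<dots> = (\<integral>\<^sup>+y. ennreal (g y powr p) * (ennreal (W y) * (\<integral>\<^sup>+s. ennreal (V (y + \<eta> s)) \<partial>\<mu>)) \<partial>lborel)"
    by (subst nn_integral_multc) (auto simp: ennreal_mult' W mult_ac)
  also have "\<dots> \<le> (\<integral>\<^sup>+y. ennreal C2 * ennreal (g y powr p * \<omega> y) \<partial>lborel)"
  proof (rule nn_integral_mono_AE)
    show "AE y in lborel. ennreal (g y powr p) * (ennreal (W y) * (\<integral>\<^sup>+s. ennreal (V (y + \<eta> s)) \<partial>\<mu>))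
      \<le> ennreal C2 * ennreal (g y powr p * \<omega> y)"
      using primal
    proof eventually_elim
      case (elim y)
      have "ennreal (g y powr p) * (ennreal (W y) * (\<integral>\<^sup>+s. ennreal (V (y + \<eta> s)) \<partial>\<mu>))
        \<le> ennreal (g y powr p) * ennreal (C2 * \<omega> y)"
        by (rule mult_left_mono[OF elim]) simp
      also have "\<dots> = ennreal C2 * ennreal (g y powr p * \<omega> y)"
        using C2 \<omega> by (simp add: ennreal_mult' mult_ac)
      finally show ?case .
    qed
  qed
  also have "\<dots> = ennreal C2 * (\<integral>\<^sup>+y. ennreal (g y powr p * \<omega> y) \<partial>lborel)"
    by (simp add: nn_integral_cmult)
  finally have Vb: "(\<integral>\<^sup>+x. ennreal (V x) * b x \<partial>lborel)
      \<le> ennreal C2 * (\<integral>\<^sup>+y. ennreal (g y powr p * \<omega> y) \<partial>lborel)" .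
  also have "\<dots> < \<infinity>" using fin by (simp add: ennreal_mult_less_top)
  finally have "AE x in lborel. ennreal (V x) * b x \<noteq> \<infinity>"
    by (intro nn_integral_PInf_AE) auto
  with pos have b_fin: "AE x in lborel. b x < \<infinity>"
    by eventually_elim (auto simp: ennreal_mult_eq_top_iff less_top)
  show thesis
  proof
    show "G \<in> borel_measurable borel" unfolding G_def by measurable
    show "0 \<le> G x" for x unfolding G_def by simp
    show "AE x in lborel. (\<integral>\<^sup>+s. ennreal (g (x - \<eta> s)) \<partial>\<mu>) \<le> ennreal (G x)"
      using pos dual b_fin
    proof eventually_elim
      case (elim x)
      show ?case unfolding G_def
      proof (rule nn_integral_weighted_Holder[where w = "\<lambda>s. W (x - \<eta> s)"])
        show "(\<integral>\<^sup>+s. ennreal (g (x - \<eta> s) powr p * W (x - \<eta> s)) \<partial>\<mu>) \<le> ennreal (enn2real (b x))"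
          using elim(3) by (simp add: b_def)
        show "0 < C1 * (V x / \<omega> x) powr (1 / (p - 1))" using elim C1 by simp
      qed (use g p elim in auto)
    qed
    have "(\<integral>\<^sup>+x. ennreal (G x powr p * \<omega> x) \<partial>lborel)
      = (\<integral>\<^sup>+x. ennreal (C1 powr (p-1)) * (ennreal (V x) * b x) \<partial>lborel)"
    proof (rule nn_integral_cong_AE)
      show "AE x in lborel. ennreal (G x powr p * \<omega> x) = ennreal (C1 powr (p-1)) * (ennreal (V x) * b x)"
        using pos b_fin
      proof eventually_elim
        case (elim x)
        have "G x powr p * \<omega> x = enn2real (b x) * (C1 powr (p-1) * (V x / \<omega> x)) * \<omega> x"
          using p C1 V[of x] \<omega>[of x] unfolding G_def by (simp add: powr_mult powr_powr)
        also have "\<dots> = C1 powr (p-1) * (V x * enn2real (b x))" using elim by simp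
        also have "ennreal \<dots> = ennreal (C1 powr (p-1)) * (ennreal (V x) * b x)"
          using elim V by (simp add: ennreal_mult')
        finally show ?case .
      qed
    qed
    also have "\<dots> = ennreal (C1 powr (p-1)) * (\<integral>\<^sup>+x. ennreal (V x) * b x \<partial>lborel)"
      by (rule nn_integral_cmult) measurable
    also have "\<dots> \<le> ennreal (C1 powr (p-1)) * (ennreal C2 * (\<integral>\<^sup>+y. ennreal (g y powr p * \<omega> y) \<partial>lborel))"
      by (intro mult_left_mono Vb) auto
    finally show "(\<integral>\<^sup>+x. ennreal (G x powr p * \<omega> x) \<partial>lborel)
      \<le> ennreal (C1 powr (p - 1) * C2) * (\<integral>\<^sup>+y. ennreal (g y powr p * \<omega> y) \<partial>lborel)"
      using C2 by (simp add: ennreal_mult' mult_ac)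
  qed
qed

text \<open>Boundedness of \<open>g \<mapsto> \<integral> g (x - \<eta> s) d\<mu>\<close> on the nonnegative functions in \<open>L\<^sup>p(\<omega>)\<close>.  A real majorant
  \<open>G\<close> replaces the average itself because the latter may be infinite on a null set.\<close>

definition averages_bounded ::
  "real \<Rightarrow> ('a::euclidean_space \<Rightarrow> real) \<Rightarrow> 'b measure \<Rightarrow> ('b \<Rightarrow> 'a) \<Rightarrow> bool" where
  "averages_bounded p \<omega> \<mu> \<eta> \<longleftrightarrow> (\<exists>C\<ge>0. \<forall>g\<in>borel_measurable borel. (\<forall>x. 0 \<le> g x) \<longrightarrow>
     (\<integral>\<^sup>+x. ennreal (g x powr p * \<omega> x) \<partial>lborel) < \<infinity> \<longrightarrow>
     (\<exists>G\<in>borel_measurable borel. (\<forall>x. 0 \<le> G x) \<and>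
        (AE x in lborel. (\<integral>\<^sup>+s. ennreal (g (x - \<eta> s)) \<partial>\<mu>) \<le> ennreal (G x)) \<and>
        (\<integral>\<^sup>+x. ennreal (G x powr p * \<omega> x) \<partial>lborel)
          \<le> ennreal C * (\<integral>\<^sup>+x. ennreal (g x powr p * \<omega> x) \<partial>lborel)))"

lemma averages_bounded_schur:
  fixes \<mu> :: "'b measure" and \<eta> :: "'b \<Rightarrow> 'a::euclidean_space" and W V \<omega> :: "'a \<Rightarrow> real"
  assumes "sigma_finite_measure \<mu>"
    "\<eta> \<in> borel_measurable \<mu>" "W \<in> borel_measurable borel"
    "V \<in> borel_measurable borel" "\<omega> \<in> borel_measurable borel"
    "\<And>x. 0 \<le> W x" "\<And>x. 0 \<le> V x" "\<And>x. 0 \<le> \<omega> x" "1 < p" "0 < C1" "0 \<le> C2"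
    "AE x in lborel. 0 < V x \<and> 0 < \<omega> x \<and> (AE s in \<mu>. 0 < W (x - \<eta> s))"
    "AE x in lborel. (\<integral>\<^sup>+s. ennreal (W (x - \<eta> s) powr (-1 / (p - 1))) \<partial>\<mu>)
      \<le> ennreal (C1 * (V x / \<omega> x) powr (1 / (p - 1)))"
    "AE y in lborel. ennreal (W y) * (\<integral>\<^sup>+s. ennreal (V (y + \<eta> s)) \<partial>\<mu>) \<le> ennreal (C2 * \<omega> y)"
  shows "averages_bounded p \<omega> \<mu> \<eta>"
  unfolding averages_bounded_def
proof (intro exI[of _ "C1 powr (p - 1) * C2"] conjI ballI impI)
  fix g :: "'a \<Rightarrow> real"
  assume "g \<in> borel_measurable borel" "\<forall>x. 0 \<le> g x" "(\<integral>\<^sup>+x. ennreal (g x powr p * \<omega> x) \<partial>lborel) < \<infinity>"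
  then obtain G where "G \<in> borel_measurable borel" "\<And>x. 0 \<le> G x"
    "AE x in lborel. (\<integral>\<^sup>+s. ennreal (g (x - \<eta> s)) \<partial>\<mu>) \<le> ennreal (G x)"
    "(\<integral>\<^sup>+x. ennreal (G x powr p * \<omega> x) \<partial>lborel)
      \<le> ennreal (C1 powr (p - 1) * C2) * (\<integral>\<^sup>+y. ennreal (g y powr p * \<omega> y) \<partial>lborel)"
    using schur_test[of \<mu> \<eta> W V \<omega> g p C1 C2] assms by blast
  then show "\<exists>G\<in>borel_measurable borel. (\<forall>x. 0 \<le> G x) \<and>
        (AE x in lborel. (\<integral>\<^sup>+s. ennreal (g (x - \<eta> s)) \<partial>\<mu>) \<le> ennreal (G x)) \<and>
        (\<integral>\<^sup>+x. ennreal (G x powr p * \<omega> x) \<partial>lborel)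
          \<le> ennreal (C1 powr (p - 1) * C2) * (\<integral>\<^sup>+x. ennreal (g x powr p * \<omega> x) \<partial>lborel)"
    by blast
qed (use assms in simp)

lemma sum_powr_le:
  fixes x :: "'i \<Rightarrow> real"
  assumes T: "finite T" and x: "\<And>i. i \<in> T \<Longrightarrow> 0 \<le> x i" and p: "0 \<le> p"
  shows "(\<Sum>i\<in>T. x i) powr p \<le> real (card T) powr p * (\<Sum>i\<in>T. x i powr p)"
proof (cases "T = {}")
  case False
  define m where "m = Max (x ` T)"
  have "m \<in> x ` T" using T False by (simp add: m_def)
  then obtain j where j: "j \<in> T" "m = x j" by auto
  have "(\<Sum>i\<in>T. x i) \<le> real (card T) * x j"
    unfolding j(2)[symmetric] using T by (intro sum_bounded_above) (simp add: m_def)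
  then have "(\<Sum>i\<in>T. x i) powr p \<le> (real (card T) * x j) powr p"
    using p x by (intro powr_mono2 sum_nonneg) auto
  also have "\<dots> = real (card T) powr p * x j powr p" using x j by (simp add: powr_mult)
  also have "\<dots> \<le> real (card T) powr p * (\<Sum>i\<in>T. x i powr p)"
    using T j by (intro mult_left_mono member_le_sum) auto
  finally show ?thesis .
qed simp

lemma averages_bounded_sum:
  fixes \<eta> :: "real \<Rightarrow> 'a::euclidean_space"
  assumes T: "finite T" and b: "\<And>i. i \<in> T \<Longrightarrow> averages_bounded p \<omega> (\<nu> i) \<eta>"
    and [measurable]: "\<eta> \<in> borel_measurable borel" "\<omega> \<in> borel_measurable borel"
    and \<omega>: "\<And>x. 0 \<le> \<omega> x" and p: "0 \<le> p" and M: "0 \<le> M"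
    and dom: "\<And>h. h \<in> borel_measurable borel \<Longrightarrow>
      (\<integral>\<^sup>+s. h s \<partial>\<mu>) \<le> ennreal M * (\<Sum>i\<in>T. (\<integral>\<^sup>+s. h s \<partial>\<nu> i))"
  shows "averages_bounded p \<omega> \<mu> \<eta>"
proof -
  have "\<exists>C. \<forall>i\<in>T. 0 \<le> C i \<and> (\<forall>g\<in>borel_measurable borel. (\<forall>x. 0 \<le> g x) \<longrightarrow>
     (\<integral>\<^sup>+x. ennreal (g x powr p * \<omega> x) \<partial>lborel) < \<infinity> \<longrightarrow>
     (\<exists>G\<in>borel_measurable borel. (\<forall>x. 0 \<le> G x) \<and>
        (AE x in lborel. (\<integral>\<^sup>+s. ennreal (g (x - \<eta> s)) \<partial>\<nu> i) \<le> ennreal (G x)) \<and>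
        (\<integral>\<^sup>+x. ennreal (G x powr p * \<omega> x) \<partial>lborel)
          \<le> ennreal (C i) * (\<integral>\<^sup>+x. ennreal (g x powr p * \<omega> x) \<partial>lborel)))"
    using b unfolding averages_bounded_def by (intro bchoice) blast
  then obtain C where C: "\<And>i. i \<in> T \<Longrightarrow> 0 \<le> C i" and
    CG: "\<And>i g. i \<in> T \<Longrightarrow> g \<in> borel_measurable borel \<Longrightarrow> (\<And>x. 0 \<le> g x) \<Longrightarrow>
     (\<integral>\<^sup>+x. ennreal (g x powr p * \<omega> x) \<partial>lborel) < \<infinity> \<Longrightarrow>
     \<exists>G\<in>borel_measurable borel. (\<forall>x. 0 \<le> G x) \<and>
        (AE x in lborel. (\<integral>\<^sup>+s. ennreal (g (x - \<eta> s)) \<partial>\<nu> i) \<le> ennreal (G x)) \<and>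
        (\<integral>\<^sup>+x. ennreal (G x powr p * \<omega> x) \<partial>lborel)
          \<le> ennreal (C i) * (\<integral>\<^sup>+x. ennreal (g x powr p * \<omega> x) \<partial>lborel)"
    by blast
  define K where "K = M powr p * real (card T) powr p"
  have K: "0 \<le> K" by (simp add: K_def)
  show ?thesis unfolding averages_bounded_def
  proof (intro exI[of _ "K * (\<Sum>i\<in>T. C i)"] conjI ballI impI)
    show "0 \<le> K * (\<Sum>i\<in>T. C i)" using C K by (simp add: sum_nonneg)
    fix g :: "'a \<Rightarrow> real"
    assume g[measurable]: "g \<in> borel_measurable borel" and g0: "\<forall>x. 0 \<le> g x"
      and fin: "(\<integral>\<^sup>+x. ennreal (g x powr p * \<omega> x) \<partial>lborel) < \<infinity>"
    let ?N = "\<integral>\<^sup>+x. ennreal (g x powr p * \<omega> x) \<partial>lborel"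
    have "\<forall>i\<in>T. \<exists>G. G \<in> borel_measurable borel \<and> (\<forall>x. 0 \<le> G x) \<and>
        (AE x in lborel. (\<integral>\<^sup>+s. ennreal (g (x - \<eta> s)) \<partial>\<nu> i) \<le> ennreal (G x)) \<and>
        (\<integral>\<^sup>+x. ennreal (G x powr p * \<omega> x) \<partial>lborel) \<le> ennreal (C i) * ?N"
      using CG[OF _ g _ fin] g0 by blast
    from bchoice[OF this] obtain H where "\<forall>i\<in>T. H i \<in> borel_measurable borel \<and> (\<forall>x. 0 \<le> H i x) \<and>
        (AE x in lborel. (\<integral>\<^sup>+s. ennreal (g (x - \<eta> s)) \<partial>\<nu> i) \<le> ennreal (H i x)) \<and>
        (\<integral>\<^sup>+x. ennreal (H i x powr p * \<omega> x) \<partial>lborel) \<le> ennreal (C i) * ?N" by blast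
    then have H[measurable]: "\<And>i. i \<in> T \<Longrightarrow> H i \<in> borel_measurable borel"
      and H0: "\<And>i x. i \<in> T \<Longrightarrow> 0 \<le> H i x"
      and HG: "\<And>i. i \<in> T \<Longrightarrow> AE x in lborel. (\<integral>\<^sup>+s. ennreal (g (x - \<eta> s)) \<partial>\<nu> i) \<le> ennreal (H i x)"
      and HN: "\<And>i. i \<in> T \<Longrightarrow> (\<integral>\<^sup>+x. ennreal (H i x powr p * \<omega> x) \<partial>lborel) \<le> ennreal (C i) * ?N"
      by blast+
    define G where "G x = M * (\<Sum>i\<in>T. H i x)" for x
    have G: "G \<in> borel_measurable borel" unfolding G_def by measurable
    have G0: "0 \<le> G x" for x using H0 M by (simp add: G_def sum_nonneg)
    have "AE x in lborel. \<forall>i\<in>T. (\<integral>\<^sup>+s. ennreal (g (x - \<eta> s)) \<partial>\<nu> i) \<le> ennreal (H i x)"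
      using HG T by (intro AE_finite_allI) auto
    then have GG: "AE x in lborel. (\<integral>\<^sup>+s. ennreal (g (x - \<eta> s)) \<partial>\<mu>) \<le> ennreal (G x)"
    proof eventually_elim
      case (elim x)
      have "(\<integral>\<^sup>+s. ennreal (g (x - \<eta> s)) \<partial>\<mu>) \<le> ennreal M * (\<Sum>i\<in>T. (\<integral>\<^sup>+s. ennreal (g (x - \<eta> s)) \<partial>\<nu> i))"
        by (rule dom) measurable
      also have "\<dots> \<le> ennreal M * (\<Sum>i\<in>T. ennreal (H i x))"
        using elim by (intro mult_left_mono sum_mono) auto
      also have "\<dots> = ennreal (G x)"
        using H0 M by (simp add: G_def ennreal_mult' sum_nonneg)
      finally show ?case .
    qed
    have "(\<integral>\<^sup>+x. ennreal (G x powr p * \<omega> x) \<partial>lborel)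
      \<le> (\<integral>\<^sup>+x. ennreal K * (\<Sum>i\<in>T. ennreal (H i x powr p * \<omega> x)) \<partial>lborel)"
    proof (rule nn_integral_mono)
      fix x
      have "G x powr p * \<omega> x = M powr p * (\<Sum>i\<in>T. H i x) powr p * \<omega> x"
        using M H0 by (simp add: G_def powr_mult sum_nonneg)
      also have "\<dots> \<le> M powr p * (real (card T) powr p * (\<Sum>i\<in>T. H i x powr p)) * \<omega> x"
        using T H0 p \<omega> by (intro mult_left_mono mult_right_mono sum_powr_le) auto
      also have "\<dots> = K * (\<Sum>i\<in>T. H i x powr p * \<omega> x)"
        unfolding K_def sum_distrib_left sum_distrib_right by (simp add: mult_ac)
      finally have "ennreal (G x powr p * \<omega> x) \<le> ennreal (K * (\<Sum>i\<in>T. H i x powr p * \<omega> x))"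
        by (rule ennreal_leI)
      also have "\<dots> = ennreal K * (\<Sum>i\<in>T. ennreal (H i x powr p * \<omega> x))"
        using K \<omega> by (subst sum_ennreal) (auto simp: ennreal_mult sum_nonneg)
      finally show "ennreal (G x powr p * \<omega> x) \<le> ennreal K * (\<Sum>i\<in>T. ennreal (H i x powr p * \<omega> x))" .
    qed
    also have "\<dots> = ennreal K * (\<Sum>i\<in>T. \<integral>\<^sup>+x. ennreal (H i x powr p * \<omega> x) \<partial>lborel)"
      by (subst nn_integral_cmult, measurable) (subst nn_integral_sum, auto)
    also have "\<dots> \<le> ennreal K * (\<Sum>i\<in>T. ennreal (C i) * ?N)"
      using HN by (intro mult_left_mono sum_mono) auto
    also have "\<dots> = ennreal (K * (\<Sum>i\<in>T. C i)) * ?N"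
      using K C by (simp add: ennreal_mult' sum_nonneg mult.assoc flip: sum_distrib_right)
    finally show "\<exists>G\<in>borel_measurable borel. (\<forall>x. 0 \<le> G x) \<and>
        (AE x in lborel. (\<integral>\<^sup>+s. ennreal (g (x - \<eta> s)) \<partial>\<mu>) \<le> ennreal (G x)) \<and>
        (\<integral>\<^sup>+x. ennreal (G x powr p * \<omega> x) \<partial>lborel) \<le> ennreal (K * (\<Sum>i\<in>T. C i)) * ?N"
      using G G0 GG by blast
  qed
qed

section \<open>One-dimensional integrals\<close>

lemma nn_integral_abs_powr_near:
  fixes s0 r \<beta> :: real
  assumes \<beta>: "\<beta> < 1" and r: "0 \<le> r"
  shows "(\<integral>\<^sup>+s. ennreal (\<bar>s - s0\<bar> powr (-\<beta>)) * indicator {s. \<bar>s - s0\<bar> \<le> r} s \<partial>lborel)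
    \<le> ennreal (2 * (r powr (1 - \<beta>) / (1 - \<beta>)))"
proof -
  define f where "f s = indicator {0..r} s * s powr (-\<beta>)" for s :: real
  have [measurable]: "f \<in> borel_measurable borel" unfolding f_def by measurable
  have f0: "0 \<le> f s" for s by (simp add: f_def)
  have "((\<lambda>s. s powr (-\<beta>)) has_integral (r powr (1 - \<beta>) / (1 - \<beta>))) {0..r}"
    using has_integral_powr_from_0[of "-\<beta>" r] \<beta> r by simp
  then have "(f has_integral (r powr (1 - \<beta>) / (1 - \<beta>))) UNIV"
    unfolding f_def has_integral_restrict_UNIV[symmetric, of _ _ "{0..r}"]
    by (rule has_integral_eq[rotated]) (simp add: indicator_def)
  then have I: "(\<integral>\<^sup>+s. ennreal (f s) \<partial>lborel) = ennreal (r powr (1 - \<beta>) / (1 - \<beta>))"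
    by (intro nn_integral_has_integral_lborel) (auto simp: f0)
  have I1: "(\<integral>\<^sup>+s. ennreal (f (s - s0)) \<partial>lborel) = ennreal (r powr (1 - \<beta>) / (1 - \<beta>))"
    using nn_integral_real_affine[of f 1 "-s0"] I by simp
  have I2: "(\<integral>\<^sup>+s. ennreal (f (s0 - s)) \<partial>lborel) = ennreal (r powr (1 - \<beta>) / (1 - \<beta>))"
    using nn_integral_real_affine[of f "-1" "s0"] I by simp
  have "(\<integral>\<^sup>+s. ennreal (\<bar>s - s0\<bar> powr (-\<beta>)) * indicator {s. \<bar>s - s0\<bar> \<le> r} s \<partial>lborel)
    \<le> (\<integral>\<^sup>+s. ennreal (f (s - s0)) + ennreal (f (s0 - s)) \<partial>lborel)"
    by (intro nn_integral_mono) (auto simp: f_def indicator_def abs_if)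
  also have "\<dots> = ennreal (r powr (1 - \<beta>) / (1 - \<beta>)) + ennreal (r powr (1 - \<beta>) / (1 - \<beta>))"
    using I1 I2 by (subst nn_integral_add) auto
  also have "\<dots> = ennreal (2 * (r powr (1 - \<beta>) / (1 - \<beta>)))"
    using \<beta> by (subst ennreal_plus[symmetric]) auto
  finally show ?thesis .
qed

lemma nn_integral_powr_tail:
  fixes s0 d k e :: real
  assumes d: "0 < d" and k: "0 < k" and e: "0 < e"
  shows "(\<integral>\<^sup>+s. ennreal ((d + k * \<bar>s - s0\<bar>) powr (-1 - e)) \<partial>lborel) \<le> ennreal (2 * (d powr (-e) / (k * e)))"
proof -
  define h where "h s = (d + k * \<bar>s\<bar>) powr (-1 - e)" for s :: real
  have [measurable]: "h \<in> borel_measurable borel" unfolding h_def by measurable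
  define f where "f s = ennreal (h s) * indicator {0..} s" for s
  have [measurable]: "f \<in> borel_measurable borel" unfolding f_def by measurable
  have "(\<integral>\<^sup>+s. ennreal (h s) * indicator {0..} s \<partial>lborel)
     = ennreal (0 - (- ((d + k * 0) powr (-e) / (k * e))))"
  proof (rule nn_integral_FTC_atLeast)
    fix s :: real assume s: "0 \<le> s"
    have pos: "0 < d + k * s" using d k s by (simp add: add_pos_nonneg)
    show "((\<lambda>s. - ((d + k * s) powr (-e) / (k * e))) has_real_derivative h s) (at s)"
      unfolding h_def minus_diff_commute[of 1 e] using pos k e s
      by (auto intro!: derivative_eq_intros simp: field_simps diff_diff_eq)
  next
    have "filterlim (\<lambda>s. d + k * s) at_top at_top"
      using k by (intro filterlim_tendsto_add_at_top tendsto_const filterlim_tendsto_pos_mult_at_top[OF _ _ filterlim_ident]) auto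
    then have "((\<lambda>s. (d + k * s) powr (-e)) \<longlongrightarrow> 0) at_top"
      using e by (intro tendsto_neg_powr) auto
    then show "((\<lambda>s. - ((d + k * s) powr (-e) / (k * e))) \<longlongrightarrow> 0) at_top"
      using tendsto_minus[OF tendsto_divide[OF _ tendsto_const, of "\<lambda>s. (d + k * s) powr (-e)" 0 at_top "k * e"]] k e by simp
  qed (auto simp: h_def)
  then have I: "(\<integral>\<^sup>+s. f s \<partial>lborel) = ennreal (d powr (-e) / (k * e))" by (simp add: f_def)
  have I1: "(\<integral>\<^sup>+s. f (s - s0) \<partial>lborel) = ennreal (d powr (-e) / (k * e))"
    using nn_integral_real_affine[of f 1 "-s0"] I by simp
  have I2: "(\<integral>\<^sup>+s. f (s0 - s) \<partial>lborel) = ennreal (d powr (-e) / (k * e))"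
    using nn_integral_real_affine[of f "-1" "s0"] I by simp
  have "(\<integral>\<^sup>+s. ennreal ((d + k * \<bar>s - s0\<bar>) powr (-1 - e)) \<partial>lborel)
    \<le> (\<integral>\<^sup>+s. f (s - s0) + f (s0 - s) \<partial>lborel)"
    by (intro nn_integral_mono) (auto simp: f_def h_def indicator_def abs_if)
  also have "\<dots> = ennreal (d powr (-e) / (k * e)) + ennreal (d powr (-e) / (k * e))"
    using I1 I2 by (subst nn_integral_add) auto
  also have "\<dots> = ennreal (2 * (d powr (-e) / (k * e)))"
    using k e by (subst ennreal_plus[symmetric]) auto
  finally show ?thesis .
qed

section \<open>Averages over a short curved arc\<close>

locale curved_arc =
  fixes J :: "real set" and \<eta> :: "real \<Rightarrow> 'a::euclidean_space" and c L D :: real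
  assumes J: "compact J" "J \<noteq> {}"
    and c: "0 < c" and L: "0 \<le> L" and D: "0 < D"
    and diam: "\<And>s s'. s \<in> J \<Longrightarrow> s' \<in> J \<Longrightarrow> \<bar>s - s'\<bar> \<le> D"
    and lipschitz: "\<And>s s'. s \<in> J \<Longrightarrow> s' \<in> J \<Longrightarrow> norm (\<eta> s - \<eta> s') \<le> L * \<bar>s - s'\<bar>"
    and expansive: "\<And>s s'. s \<in> J \<Longrightarrow> s' \<in> J \<Longrightarrow> c * \<bar>s - s'\<bar> \<le> norm (\<eta> s - \<eta> s')"
    and chord: "\<And>s1 s1' s2 s2'. s1 \<in> J \<Longrightarrow> s1' \<in> J \<Longrightarrow> s2 \<in> J \<Longrightarrow> s2' \<in> J \<Longrightarrow>
      c * (\<bar>s1 - s1'\<bar> * \<bar>s1 - s2\<bar>) \<le> norm (\<eta> s1 - \<eta> s1' - (\<eta> s2 - \<eta> s2'))"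
begin

definition \<rho> :: "'a \<Rightarrow> real" where "\<rho> y = infdist y (\<eta> ` J)"

lemma continuous: "continuous_on J \<eta>"
proof -
  have "L-lipschitz_on J \<eta>"
    using lipschitz L by (intro lipschitz_onI) (auto simp: dist_norm)
  then show ?thesis by (rule lipschitz_on_continuous_on)
qed

lemma compact_image: "compact (\<eta> ` J)"
  by (intro compact_continuous_image continuous J)

lemma continuous_\<rho>: "continuous_on UNIV \<rho>"
  unfolding \<rho>_def by (intro continuous_intros)

lemma \<rho>_nonneg: "0 \<le> \<rho> y" by (simp add: \<rho>_def infdist_nonneg)

lemma \<rho>_le: "s \<in> J \<Longrightarrow> \<rho> y \<le> norm (y - \<eta> s)"
  unfolding \<rho>_def by (metis dist_norm imageI infdist_le)

lemma \<rho>_attained: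
  obtains s where "s \<in> J" "\<rho> y = norm (y - \<eta> s)"
  unfolding \<rho>_def using infdist_attains_inf[of "\<eta> ` J" y] compact_image J
  by (auto simp: dist_norm compact_imp_closed)

lemma \<rho>_eq_0_iff: "\<rho> y = 0 \<longleftrightarrow> y \<in> \<eta> ` J"
  unfolding \<rho>_def using compact_image J by (subst in_closed_iff_infdist_zero) (auto simp: compact_imp_closed)

lemma norm_diff_lower_bound:
  obtains k where "0 < k" "\<And>y. \<exists>s0\<in>J. \<forall>s\<in>J. k * norm y * \<bar>s - s0\<bar> \<le> norm (y - \<eta> s)"
proof -
  obtain M where M: "0 < M" "\<And>s. s \<in> J \<Longrightarrow> norm (\<eta> s) \<le> M"
    using compact_imp_bounded[OF compact_image] unfolding bounded_pos by auto
  define k where "k = min (c / (4 * M)) (1 / (2 * D))"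
  have k: "0 < k" "k \<le> c / (4 * M)" "k \<le> 1 / (2 * D)" using c M D by (auto simp: k_def)
  have "\<exists>s0\<in>J. \<forall>s\<in>J. k * norm y * \<bar>s - s0\<bar> \<le> norm (y - \<eta> s)" for y
  proof -
    obtain s0 where s0: "s0 \<in> J" "\<rho> y = norm (y - \<eta> s0)" by (rule \<rho>_attained)
    have "k * norm y * \<bar>s - s0\<bar> \<le> norm (y - \<eta> s)" if s: "s \<in> J" for s
    proof (cases "norm y \<le> 2 * M")
      case True
      have "c * \<bar>s - s0\<bar> \<le> norm (\<eta> s - \<eta> s0)" using expansive s s0 by simp
      also have "\<dots> = norm ((y - \<eta> s0) - (y - \<eta> s))" by simp
      also have "\<dots> \<le> norm (y - \<eta> s0) + norm (y - \<eta> s)" by (rule norm_triangle_ineq4)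
      also have "\<dots> \<le> 2 * norm (y - \<eta> s)" using \<rho>_le[OF s, of y] s0 by simp
      finally have *: "c / 2 * \<bar>s - s0\<bar> \<le> norm (y - \<eta> s)" by simp
      have "k * norm y \<le> c / (4 * M) * (2 * M)" using k True M c by (intro mult_mono) auto
      also have "\<dots> = c / 2" using M by simp
      finally have "k * norm y * \<bar>s - s0\<bar> \<le> c / 2 * \<bar>s - s0\<bar>" by (intro mult_right_mono) auto
      with * show ?thesis by simp
    next
      case False
      have "k * norm y * \<bar>s - s0\<bar> \<le> 1 / (2 * D) * norm y * D"
        using k D diam[OF s s0(1)] by (intro mult_mono) auto
      also have "\<dots> = norm y / 2" using D by simp
      also have "\<dots> \<le> norm y - norm (\<eta> s)" using False M(2)[OF s] by simp
      also have "\<dots> \<le> norm (y - \<eta> s)" by (rule norm_triangle_ineq2)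
      finally show ?thesis .
    qed
    with s0 show ?thesis by blast
  qed
  with k that show thesis by blast
qed

lemma \<rho>_lower_bound:
  obtains k where "0 < k" "\<And>x. \<exists>s0\<in>J. \<forall>s\<in>J. k * norm x * \<bar>s - s0\<bar> \<le> \<rho> (x + \<eta> s)"
proof -
  define k where "k = 1 / (2 * L / c + D)"
  have k: "0 < k" using c L D by (simp add: k_def add_nonneg_pos)
  have "\<exists>s0\<in>J. \<forall>s\<in>J. k * norm x * \<bar>s - s0\<bar> \<le> \<rho> (x + \<eta> s)" for x
  proof -
    have "continuous_on J (\<lambda>s. \<rho> (x + \<eta> s))"
      by (intro continuous_on_compose2[OF continuous_\<rho>] continuous_intros continuous) auto
    from continuous_attains_inf[OF J this] obtain s0
      where s0: "s0 \<in> J" "\<And>s. s \<in> J \<Longrightarrow> \<rho> (x + \<eta> s0) \<le> \<rho> (x + \<eta> s)" by auto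
    obtain s0' where s0': "s0' \<in> J" "\<rho> (x + \<eta> s0) = norm (x + \<eta> s0 - \<eta> s0')" by (rule \<rho>_attained)
    have "k * norm x * \<bar>s - s0\<bar> \<le> \<rho> (x + \<eta> s)" if s: "s \<in> J" for s
    proof -
      define \<delta> where "\<delta> = \<rho> (x + \<eta> s)"
      obtain s' where s': "s' \<in> J" "\<delta> = norm (x + \<eta> s - \<eta> s')"
        unfolding \<delta>_def by (rule \<rho>_attained)
      have \<delta>: "0 \<le> \<delta>" by (simp add: s')
      have "c * (\<bar>s - s'\<bar> * \<bar>s - s0\<bar>) \<le> norm (\<eta> s - \<eta> s' - (\<eta> s0 - \<eta> s0'))"
        using s s0 s0' s' by (intro chord) auto
      also have "\<dots> = norm ((x + \<eta> s - \<eta> s') - (x + \<eta> s0 - \<eta> s0'))" by (simp add: algebra_simps)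
      also have "\<dots> \<le> \<delta> + \<rho> (x + \<eta> s0)" unfolding s' s0' by (rule norm_triangle_ineq4)
      also have "\<dots> \<le> 2 * \<delta>" using s0(2)[OF s] by (simp add: \<delta>_def)
      finally have 1: "\<bar>s - s'\<bar> * \<bar>s - s0\<bar> \<le> 2 * \<delta> / c" using c by (simp add: field_simps)
      have "norm x = norm ((x + \<eta> s - \<eta> s') - (\<eta> s - \<eta> s'))" by simp
      also have "\<dots> \<le> \<delta> + norm (\<eta> s - \<eta> s')" unfolding s' by (rule norm_triangle_ineq4)
      also have "\<dots> \<le> \<delta> + L * \<bar>s - s'\<bar>" using lipschitz s s' by simp
      finally have "norm x * \<bar>s - s0\<bar> \<le> (\<delta> + L * \<bar>s - s'\<bar>) * \<bar>s - s0\<bar>" by (rule mult_right_mono) simp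
      also have "\<dots> = \<delta> * \<bar>s - s0\<bar> + L * (\<bar>s - s'\<bar> * \<bar>s - s0\<bar>)" by (simp add: algebra_simps)
      also have "\<dots> \<le> \<delta> * D + L * (2 * \<delta> / c)"
        using \<delta> L 1 diam[OF s s0(1)] by (intro add_mono mult_left_mono) auto
      also have "\<dots> = \<delta> * (2 * L / c + D)" by (simp add: algebra_simps)
      finally have "norm x * \<bar>s - s0\<bar> \<le> \<delta> / k" by (simp add: k_def)
      then show ?thesis using k by (simp add: \<delta>_def field_simps)
    qed
    with s0 show ?thesis by blast
  qed
  with k that show thesis by blast
qed

abbreviation \<mu> :: "real measure" where "\<mu> \<equiv> density lborel (indicator J)"

lemma J_borel [measurable]: "J \<in> sets borel"
  using J by (simp add: borel_compact)

lemma AE_\<mu>_neq: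
  assumes "\<And>s. s \<in> J \<Longrightarrow> s \<noteq> s0 \<Longrightarrow> P s" shows "AE s in \<mu>. P s"
proof -
  have "AE s in lborel. s \<noteq> s0" by (rule AE_lborel_singleton)
  then have "AE s in lborel. 0 < (indicator J s :: ennreal) \<longrightarrow> P s"
    by eventually_elim (use assms in \<open>auto simp: indicator_def split: if_splits\<close>)
  then show ?thesis by (subst AE_density) auto
qed

lemma nn_integral_powr_near:
  assumes \<beta>: "0 \<le> \<beta>" "\<beta> < 1" and k: "0 < k" and r: "0 < r" and s0: "s0 \<in> J"
    and lower: "\<And>s. s \<in> J \<Longrightarrow> k * r * \<bar>s - s0\<bar> \<le> \<phi> s"
  shows "(\<integral>\<^sup>+s. ennreal (\<phi> s powr (-\<beta>)) \<partial>\<mu>)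
    \<le> ennreal (k powr (-\<beta>) * (2 * (D powr (1 - \<beta>) / (1 - \<beta>))) * r powr (-\<beta>))"
proof -
  have "(\<integral>\<^sup>+s. ennreal (\<phi> s powr (-\<beta>)) \<partial>\<mu>)
     \<le> (\<integral>\<^sup>+s. ennreal ((k * r) powr (-\<beta>)) * ennreal (\<bar>s - s0\<bar> powr (-\<beta>)) \<partial>\<mu>)"
  proof (rule nn_integral_mono_AE, rule AE_\<mu>_neq[of s0])
    fix s assume s: "s \<in> J" "s \<noteq> s0"
    have "\<phi> s powr (-\<beta>) \<le> (k * r * \<bar>s - s0\<bar>) powr (-\<beta>)"
      using s k r \<beta> by (intro powr_mono2' lower) auto
    also have "\<dots> = (k * r) powr (-\<beta>) * \<bar>s - s0\<bar> powr (-\<beta>)"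
      using k r by (simp add: powr_mult)
    finally show "ennreal (\<phi> s powr (-\<beta>)) \<le> ennreal ((k * r) powr (-\<beta>)) * ennreal (\<bar>s - s0\<bar> powr (-\<beta>))"
      by (simp flip: ennreal_mult add: ennreal_leI)
  qed
  also have "\<dots> = ennreal ((k * r) powr (-\<beta>)) * (\<integral>\<^sup>+s. ennreal (\<bar>s - s0\<bar> powr (-\<beta>)) \<partial>\<mu>)"
    by (rule nn_integral_cmult) auto
  also have "(\<integral>\<^sup>+s. ennreal (\<bar>s - s0\<bar> powr (-\<beta>)) \<partial>\<mu>)
     \<le> (\<integral>\<^sup>+s. ennreal (\<bar>s - s0\<bar> powr (-\<beta>)) * indicator {s. \<bar>s - s0\<bar> \<le> D} s \<partial>lborel)"
    using diam[OF _ s0] by (subst nn_integral_density) (auto intro!: nn_integral_mono simp: indicator_def)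
  also have "\<dots> \<le> ennreal (2 * (D powr (1 - \<beta>) / (1 - \<beta>)))"
    using \<beta> D by (intro nn_integral_abs_powr_near) auto
  finally have "(\<integral>\<^sup>+s. ennreal (\<phi> s powr (-\<beta>)) \<partial>\<mu>)
    \<le> ennreal ((k * r) powr (-\<beta>)) * ennreal (2 * (D powr (1 - \<beta>) / (1 - \<beta>)))"
    by (simp add: mult_left_mono)
  also have "\<dots> = ennreal (k powr (-\<beta>) * (2 * (D powr (1 - \<beta>) / (1 - \<beta>))) * r powr (-\<beta>))"
    using k r \<beta> by (subst ennreal_mult[symmetric]) (auto simp: powr_mult mult_ac)
  finally show ?thesis .
qed

lemma nn_integral_norm_powr:
  assumes \<beta>: "0 \<le> \<beta>" "\<beta> < 1"
  obtains C where "0 < C" "\<And>y. y \<noteq> 0 \<Longrightarrow>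
    (\<integral>\<^sup>+s. ennreal (norm (y - \<eta> s) powr (-\<beta>)) \<partial>\<mu>) \<le> ennreal (C * norm y powr (-\<beta>))"
proof -
  obtain k where k: "0 < k" "\<And>y. \<exists>s0\<in>J. \<forall>s\<in>J. k * norm y * \<bar>s - s0\<bar> \<le> norm (y - \<eta> s)"
    by (rule norm_diff_lower_bound) blast
  show thesis
  proof (rule that[of "k powr (-\<beta>) * (2 * (D powr (1 - \<beta>) / (1 - \<beta>)))"])
    fix y :: 'a assume y: "y \<noteq> 0"
    from k(2)[of y] obtain s0 where s0: "s0 \<in> J" "\<And>s. s \<in> J \<Longrightarrow> k * norm y * \<bar>s - s0\<bar> \<le> norm (y - \<eta> s)"
      by blast
    show "(\<integral>\<^sup>+s. ennreal (norm (y - \<eta> s) powr (-\<beta>)) \<partial>\<mu>)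
      \<le> ennreal (k powr (-\<beta>) * (2 * (D powr (1 - \<beta>) / (1 - \<beta>))) * norm y powr (-\<beta>))"
      using \<beta> k(1) y s0 by (intro nn_integral_powr_near[of \<beta> k "norm y" s0]) auto
  qed (use k \<beta> D in auto)
qed

lemma nn_integral_\<rho>_powr:
  assumes \<beta>: "0 \<le> \<beta>" "\<beta> < 1"
  obtains C where "0 < C" "\<And>x. x \<noteq> 0 \<Longrightarrow>
    (\<integral>\<^sup>+s. ennreal (\<rho> (x + \<eta> s) powr (-\<beta>)) \<partial>\<mu>) \<le> ennreal (C * norm x powr (-\<beta>))"
proof -
  obtain k where k: "0 < k" "\<And>x. \<exists>s0\<in>J. \<forall>s\<in>J. k * norm x * \<bar>s - s0\<bar> \<le> \<rho> (x + \<eta> s)"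
    by (rule \<rho>_lower_bound) blast
  show thesis
  proof (rule that[of "k powr (-\<beta>) * (2 * (D powr (1 - \<beta>) / (1 - \<beta>)))"])
    fix x :: 'a assume x: "x \<noteq> 0"
    from k(2)[of x] obtain s0 where s0: "s0 \<in> J" "\<And>s. s \<in> J \<Longrightarrow> k * norm x * \<bar>s - s0\<bar> \<le> \<rho> (x + \<eta> s)"
      by blast
    show "(\<integral>\<^sup>+s. ennreal (\<rho> (x + \<eta> s) powr (-\<beta>)) \<partial>\<mu>)
      \<le> ennreal (k powr (-\<beta>) * (2 * (D powr (1 - \<beta>) / (1 - \<beta>))) * norm x powr (-\<beta>))"
      using \<beta> k(1) x s0 by (intro nn_integral_powr_near[of \<beta> k "norm x" s0]) auto
  qed (use k \<beta> D in auto)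
qed

lemma nn_integral_norm_powr_singular:
  assumes e: "0 < e"
  obtains C where "0 < C" "\<And>y. y \<noteq> 0 \<Longrightarrow> 0 < \<rho> y \<Longrightarrow>
    (\<integral>\<^sup>+s. ennreal (norm (y - \<eta> s) powr (-1 - e)) \<partial>\<mu>) \<le> ennreal (C * (\<rho> y powr (-e) / norm y))"
proof -
  obtain k where k: "0 < k" "\<And>y. \<exists>s0\<in>J. \<forall>s\<in>J. k * norm y * \<bar>s - s0\<bar> \<le> norm (y - \<eta> s)"
    by (rule norm_diff_lower_bound) blast
  define C where "C = 2 powr (1 + e) * 2 / (k * e)"
  show thesis
  proof (rule that[of C])
    show "0 < C" using k e by (simp add: C_def)
    fix y :: 'a assume y: "y \<noteq> 0" and \<rho>: "0 < \<rho> y"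
    from k(2)[of y] obtain s0 where s0: "s0 \<in> J" "\<And>s. s \<in> J \<Longrightarrow> k * norm y * \<bar>s - s0\<bar> \<le> norm (y - \<eta> s)"
      by blast
    have "(\<integral>\<^sup>+s. ennreal (norm (y - \<eta> s) powr (-1 - e)) \<partial>\<mu>)
      \<le> (\<integral>\<^sup>+s. ennreal (2 powr (1 + e)) * ennreal ((\<rho> y + (k * norm y) * \<bar>s - s0\<bar>) powr (-1 - e)) \<partial>\<mu>)"
    proof (rule nn_integral_mono_AE, rule AE_\<mu>_neq[of s0])
      fix s assume s: "s \<in> J" "s \<noteq> s0"
      let ?t = "\<rho> y + (k * norm y) * \<bar>s - s0\<bar>"
      have t: "0 < ?t" using \<rho> k y by (simp add: add_pos_nonneg)
      have "?t / 2 \<le> norm (y - \<eta> s)"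
        using s0(2)[OF s(1)] \<rho>_le[OF s(1), of y] by simp
      then have "norm (y - \<eta> s) powr (-1 - e) \<le> (?t / 2) powr (-1 - e)"
        using t e by (intro powr_mono2') auto
      also have "\<dots> = 2 powr (1 + e) * ?t powr (-1 - e)"
        using t by (simp add: powr_divide powr_minus_divide[of 2 "1 + e", simplified] powr_diff powr_add powr_minus field_simps)
      finally show "ennreal (norm (y - \<eta> s) powr (-1 - e)) \<le> ennreal (2 powr (1 + e)) * ennreal (?t powr (-1 - e))"
        by (simp flip: ennreal_mult add: ennreal_leI)
    qed
    also have "\<dots> = ennreal (2 powr (1 + e)) * (\<integral>\<^sup>+s. ennreal ((\<rho> y + (k * norm y) * \<bar>s - s0\<bar>) powr (-1 - e)) \<partial>\<mu>)"
      by (rule nn_integral_cmult) auto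
    also have "(\<integral>\<^sup>+s. ennreal ((\<rho> y + (k * norm y) * \<bar>s - s0\<bar>) powr (-1 - e)) \<partial>\<mu>)
      \<le> (\<integral>\<^sup>+s. ennreal ((\<rho> y + (k * norm y) * \<bar>s - s0\<bar>) powr (-1 - e)) \<partial>lborel)"
      by (subst nn_integral_density) (auto intro!: nn_integral_mono simp: indicator_def)
    also have "\<dots> \<le> ennreal (2 * (\<rho> y powr (-e) / ((k * norm y) * e)))"
      using \<rho> k y e by (intro nn_integral_powr_tail) auto
    finally have "(\<integral>\<^sup>+s. ennreal (norm (y - \<eta> s) powr (-1 - e)) \<partial>\<mu>)
      \<le> ennreal (2 powr (1 + e)) * ennreal (2 * (\<rho> y powr (-e) / ((k * norm y) * e)))"
      by (simp add: mult_left_mono)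
    also have "\<dots> = ennreal (C * (\<rho> y powr (-e) / norm y))"
      using k e by (subst ennreal_mult[symmetric]) (auto simp: C_def field_simps)
    finally show "(\<integral>\<^sup>+s. ennreal (norm (y - \<eta> s) powr (-1 - e)) \<partial>\<mu>) \<le> ennreal (C * (\<rho> y powr (-e) / norm y))" .
  qed
qed

lemma sigma_finite_\<mu>: "sigma_finite_measure \<mu>"
  by (rule finite_measure.axioms(1), rule finite_measureI)
    (use emeasure_compact_finite[OF J(1)] in \<open>simp add: emeasure_density less_top\<close>)

lemma \<mu>_total:
  obtains C where "0 < C" "emeasure \<mu> UNIV \<le> ennreal C"
proof (rule that[of "measure lborel J + 1"])
  have "emeasure \<mu> UNIV = emeasure lborel J" by (simp add: emeasure_density)
  also have "\<dots> = ennreal (measure lborel J)"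
    by (rule emeasure_eq_ennreal_measure) (use emeasure_compact_finite[OF J(1)] in \<open>simp add: less_top\<close>)
  also have "\<dots> \<le> ennreal (measure lborel J + 1)" by (intro ennreal_leI) simp
  finally show "emeasure \<mu> UNIV \<le> ennreal (measure lborel J + 1)" .
qed (simp add: add_nonneg_pos)

lemma AE_\<mu>_neq_\<eta>: "AE s in \<mu>. y \<noteq> \<eta> s"
proof (cases "\<exists>s0\<in>J. y = \<eta> s0")
  case True
  then obtain s0 where s0: "s0 \<in> J" "y = \<eta> s0" by blast
  show ?thesis
  proof (rule AE_\<mu>_neq[of s0])
    fix s assume s: "s \<in> J" "s \<noteq> s0"
    have "0 < c * \<bar>s - s0\<bar>" using c s by simp
    also have "\<dots> \<le> norm (\<eta> s - \<eta> s0)" using s s0 by (intro expansive) auto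
    finally show "y \<noteq> \<eta> s" using s0 by auto
  qed
next
  case False
  then show ?thesis by (intro AE_\<mu>_neq) auto
qed

lemma AE_\<mu>_\<rho>_pos:
  assumes "x \<noteq> 0" shows "AE s in \<mu>. 0 < \<rho> (x + \<eta> s)"
proof -
  obtain k where k: "0 < k" "\<And>x. \<exists>s0\<in>J. \<forall>s\<in>J. k * norm x * \<bar>s - s0\<bar> \<le> \<rho> (x + \<eta> s)"
    by (rule \<rho>_lower_bound) blast
  from k(2)[of x] obtain s0 where s0: "\<And>s. s \<in> J \<Longrightarrow> k * norm x * \<bar>s - s0\<bar> \<le> \<rho> (x + \<eta> s)"
    by blast
  show ?thesis
  proof (rule AE_\<mu>_neq[of s0])
    fix s assume s: "s \<in> J" "s \<noteq> s0"
    have "0 < k * norm x * \<bar>s - s0\<bar>" using k(1) assms s by simp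
    also have "\<dots> \<le> \<rho> (x + \<eta> s)" using s by (intro s0)
    finally show "0 < \<rho> (x + \<eta> s)" .
  qed
qed

lemma AE_\<rho>_pos:
  assumes "2 \<le> DIM('a)" "\<eta> differentiable_on J"
  shows "AE x in lborel. 0 < \<rho> x"
proof -
  have "negligible (\<eta> ` J)"
    using assms by (intro negligible_differentiable_image_lowdim) auto
  moreover have "\<eta> ` J \<in> sets borel" using compact_image by (rule borel_compact)
  ultimately have "\<eta> ` J \<in> null_sets lborel"
    by (auto simp: negligible_iff_null_sets null_sets_def)
  then have "AE x in lborel. x \<notin> \<eta> ` J" by (rule AE_not_in)
  then show ?thesis
    by eventually_elim (use \<rho>_nonneg \<rho>_eq_0_iff in \<open>auto simp: less_le\<close>)
qed

lemma averages_bounded_norm_powr: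
  assumes dim: "2 \<le> DIM('a)" and diff: "\<eta> differentiable_on J"
    and \<eta>[measurable]: "\<eta> \<in> borel_measurable borel"
    and p: "1 < p" and \<alpha>: "-1 \<le> \<alpha>" "\<alpha> \<le> p - 1"
  shows "averages_bounded p (\<lambda>x. norm x powr \<alpha>) \<mu> \<eta>"
proof -
  have [measurable]: "\<rho> \<in> borel_measurable borel"
    by (rule borel_measurable_continuous_onI[OF continuous_\<rho>])
  have ne0: "AE x in lborel. x \<noteq> (0::'a)" by (rule AE_lborel_singleton)
  obtain m where m: "0 < m" "emeasure \<mu> UNIV \<le> ennreal m" by (rule \<mu>_total)
  note schur = averages_bounded_schur[OF sigma_finite_\<mu>, where \<eta> = \<eta> and p = p]
  \<comment> \<open>In the second and fourth case the weights are those of the dual operator for the exponent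
    \<open>-\<alpha> / (p - 1)\<close>, which falls under the first and third case.\<close>
  consider "-1 < \<alpha>" "\<alpha> \<le> 0" | "0 \<le> \<alpha>" "\<alpha> < p - 1" | "\<alpha> = -1" | "\<alpha> = p - 1"
    using \<alpha> by linarith
  then show ?thesis
  proof cases
    case 1
    obtain C where C: "0 < C" "\<And>y. y \<noteq> 0 \<Longrightarrow>
      (\<integral>\<^sup>+s. ennreal (norm (y - \<eta> s) powr (- (-\<alpha>))) \<partial>\<mu>) \<le> ennreal (C * norm y powr (- (-\<alpha>)))"
      by (rule nn_integral_norm_powr[of "-\<alpha>"]) (use 1 in auto)
    show ?thesis
    proof (rule schur[where W = "\<lambda>_. 1" and V = "\<lambda>x. norm x powr \<alpha>" and ?C1.0 = m and ?C2.0 = C])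
      show "AE x::'a in lborel. (\<integral>\<^sup>+s. ennreal (1 powr (-1 / (p - 1))) \<partial>\<mu>)
        \<le> ennreal (m * (norm x powr \<alpha> / norm x powr \<alpha>) powr (1 / (p - 1)))"
        using ne0 by eventually_elim (use m in simp)
      show "AE y in lborel. ennreal 1 * (\<integral>\<^sup>+s. ennreal (norm (y + \<eta> s) powr \<alpha>) \<partial>\<mu>) \<le> ennreal (C * norm y powr \<alpha>)"
        using ne0
      proof eventually_elim
        case (elim y)
        have "norm (- y - \<eta> s) = norm (y + \<eta> s)" for s by (metis minus_add_distrib norm_minus_cancel uminus_add_conv_diff add.commute)
        then show ?case using C(2)[of "-y"] elim by simp
      qed
      show "AE x::'a in lborel. 0 < norm x powr \<alpha> \<and> 0 < norm x powr \<alpha> \<and> (AE s in \<mu>. (0::real) < 1)"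
        using ne0 by eventually_elim simp
    qed (use m C p in auto)
  next
    case 2
    define \<beta> where "\<beta> = \<alpha> / (p - 1)"
    have \<beta>: "0 \<le> \<beta>" "\<beta> < 1" using 2 p by (auto simp: \<beta>_def)
    obtain C where C: "0 < C" "\<And>y. y \<noteq> 0 \<Longrightarrow>
      (\<integral>\<^sup>+s. ennreal (norm (y - \<eta> s) powr (- \<beta>)) \<partial>\<mu>) \<le> ennreal (C * norm y powr (- \<beta>))"
      by (rule nn_integral_norm_powr[OF \<beta>]) blast
    show ?thesis
    proof (rule schur[where W = "\<lambda>y. norm y powr \<alpha>" and V = "\<lambda>_. 1" and ?C1.0 = C and ?C2.0 = m])
      show "AE x in lborel. (\<integral>\<^sup>+s. ennreal ((norm (x - \<eta> s) powr \<alpha>) powr (-1 / (p - 1))) \<partial>\<mu>)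
        \<le> ennreal (C * (1 / norm x powr \<alpha>) powr (1 / (p - 1)))"
        using ne0
      proof eventually_elim
        case (elim x)
        then show ?case
          using C(2)[OF elim] by (simp add: powr_powr \<beta>_def powr_divide powr_minus_divide)
      qed
      show "AE y::'a in lborel. ennreal (norm y powr \<alpha>) * (\<integral>\<^sup>+s. ennreal 1 \<partial>\<mu>) \<le> ennreal (m * norm y powr \<alpha>)"
      proof (rule AE_I2)
        fix y :: 'a
        have "ennreal (norm y powr \<alpha>) * (\<integral>\<^sup>+s. ennreal 1 \<partial>\<mu>) \<le> ennreal (norm y powr \<alpha>) * ennreal m"
          using m by (intro mult_left_mono) auto
        also have "\<dots> = ennreal (m * norm y powr \<alpha>)" using m by (simp add: ennreal_mult' mult_ac)
        finally show "ennreal (norm y powr \<alpha>) * (\<integral>\<^sup>+s. ennreal 1 \<partial>\<mu>) \<le> ennreal (m * norm y powr \<alpha>)" .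
      qed
      show "AE x in lborel. 0 < (1::real) \<and> 0 < norm x powr \<alpha> \<and> (AE s in \<mu>. 0 < norm (x - \<eta> s) powr \<alpha>)"
        using ne0 by eventually_elim (use AE_\<mu>_neq_\<eta> in auto)
    qed (use m C p in auto)
  next
    case 3
    define e where "e = (p - 1) / 2"
    have e: "0 < e" "e / (p - 1) = 1/2" using p by (auto simp: e_def field_simps)
    obtain C1 where C1: "0 < C1" "\<And>x. x \<noteq> 0 \<Longrightarrow>
      (\<integral>\<^sup>+s. ennreal (\<rho> (x + \<eta> s) powr (- (1/2))) \<partial>\<mu>) \<le> ennreal (C1 * norm x powr (- (1/2)))"
      by (rule nn_integral_\<rho>_powr[of "1/2"]) auto
    obtain C2 where C2: "0 < C2" "\<And>y. y \<noteq> 0 \<Longrightarrow> 0 < \<rho> y \<Longrightarrow>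
      (\<integral>\<^sup>+s. ennreal (norm (y - \<eta> s) powr (-1 - e)) \<partial>\<mu>) \<le> ennreal (C2 * (\<rho> y powr (-e) / norm y))"
      by (rule nn_integral_norm_powr_singular[OF e(1)]) blast
    show ?thesis
    proof (rule schur[where W = "\<lambda>y. \<rho> (- y) powr e" and V = "\<lambda>x. norm x powr (-1 - e)"
          and ?C1.0 = C1 and ?C2.0 = C2])
      show "AE x in lborel. (\<integral>\<^sup>+s. ennreal ((\<rho> (- (x - \<eta> s)) powr e) powr (-1 / (p - 1))) \<partial>\<mu>)
        \<le> ennreal (C1 * (norm x powr (-1 - e) / norm x powr \<alpha>) powr (1 / (p - 1)))"
        using ne0
      proof eventually_elim
        case (elim x)
        have "norm x powr (-1 - e) / norm x powr \<alpha> = norm x powr (- e)"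
          by (subst powr_diff[symmetric]) (simp add: 3)
        then have "(norm x powr (-1 - e) / norm x powr \<alpha>) powr (1 / (p - 1)) = norm x powr (- (1/2))"
          by (simp add: powr_powr e(2))
        moreover have "(\<rho> (- (x - \<eta> s)) powr e) powr (-1 / (p - 1)) = \<rho> (-x + \<eta> s) powr (- (1/2))" for s
          by (simp add: powr_powr e(2))
        ultimately show ?case using C1(2)[of "-x"] elim by simp
      qed
      show "AE y in lborel. ennreal (\<rho> (- y) powr e) * (\<integral>\<^sup>+s. ennreal (norm (y + \<eta> s) powr (-1 - e)) \<partial>\<mu>)
        \<le> ennreal (C2 * norm y powr \<alpha>)"
        using ne0
      proof eventually_elim
        case (elim y)
        show ?case
        proof (cases "\<rho> (- y) = 0")
          case False
          then have r: "0 < \<rho> (-y)" using \<rho>_nonneg[of "-y"] by simp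
          have *: "norm (- y - \<eta> s) = norm (y + \<eta> s)" for s
            by (metis minus_add_distrib norm_minus_cancel uminus_add_conv_diff add.commute)
          have "ennreal (\<rho> (- y) powr e) * (\<integral>\<^sup>+s. ennreal (norm (y + \<eta> s) powr (-1 - e)) \<partial>\<mu>)
            \<le> ennreal (\<rho> (- y) powr e) * ennreal (C2 * (\<rho> (-y) powr (-e) / norm y))"
            using C2(2)[of "-y"] elim r by (intro mult_left_mono) (auto simp: *)
          also have "\<dots> = ennreal (C2 * norm y powr \<alpha>)"
            using C2(1) r elim 3 by (subst ennreal_mult[symmetric]) (auto simp: powr_minus powr_minus_divide field_simps)
          finally show ?thesis .
        qed simp
      qed
      show "AE x in lborel. 0 < norm x powr (-1 - e) \<and> 0 < norm x powr \<alpha> \<and> (AE s in \<mu>. 0 < \<rho> (- (x - \<eta> s)) powr e)"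
        using ne0
      proof eventually_elim
        case (elim x)
        have "AE s in \<mu>. 0 < \<rho> (- x + \<eta> s)" using elim by (intro AE_\<mu>_\<rho>_pos) simp
        then have "AE s in \<mu>. 0 < \<rho> (- (x - \<eta> s)) powr e"
          by eventually_elim simp
        then show ?case using elim by simp
      qed
    qed (use C1 C2 p in auto)
  next
    case 4
    define e where "e = 1 / (2 * (p - 1))"
    have e: "0 < e" using p by (simp add: e_def)
    obtain C2 where C2: "0 < C2" "\<And>x. x \<noteq> 0 \<Longrightarrow>
      (\<integral>\<^sup>+s. ennreal (\<rho> (x + \<eta> s) powr (- (1/2))) \<partial>\<mu>) \<le> ennreal (C2 * norm x powr (- (1/2)))"
      by (rule nn_integral_\<rho>_powr[of "1/2"]) auto
    obtain C1 where C1: "0 < C1" "\<And>y. y \<noteq> 0 \<Longrightarrow> 0 < \<rho> y \<Longrightarrow>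
      (\<integral>\<^sup>+s. ennreal (norm (y - \<eta> s) powr (-1 - e)) \<partial>\<mu>) \<le> ennreal (C1 * (\<rho> y powr (-e) / norm y))"
      by (rule nn_integral_norm_powr_singular[OF e]) blast
    have "(p - 1) * e = 1 / 2" using p by (simp add: e_def field_simps)
    then have pe: "(p - 1) * (1 + e) = p - 1 / 2" by (simp add: distrib_left)
    show ?thesis
    proof (rule schur[where W = "\<lambda>y. norm y powr ((p - 1) * (1 + e))" and V = "\<lambda>x. \<rho> x powr (- (1/2))"
          and ?C1.0 = C1 and ?C2.0 = C2])
      show "AE x in lborel. (\<integral>\<^sup>+s. ennreal ((norm (x - \<eta> s) powr ((p - 1) * (1 + e))) powr (-1 / (p - 1))) \<partial>\<mu>)
        \<le> ennreal (C1 * (\<rho> x powr (- (1/2)) / norm x powr \<alpha>) powr (1 / (p - 1)))"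
        using ne0 AE_\<rho>_pos[OF dim diff]
      proof eventually_elim
        case (elim x)
        have "(\<rho> x powr (- (1/2)) / norm x powr \<alpha>) powr (1 / (p - 1)) = \<rho> x powr (-e) / norm x"
          using elim p 4 by (simp add: powr_divide powr_powr e_def)
        moreover have "(norm (x - \<eta> s) powr ((p - 1) * (1 + e))) powr (-1 / (p - 1)) = norm (x - \<eta> s) powr (-1 - e)" for s
          using p by (simp add: powr_powr)
        ultimately show ?case using C1(2)[of x] elim by simp
      qed
      show "AE y in lborel. ennreal (norm y powr ((p - 1) * (1 + e))) * (\<integral>\<^sup>+s. ennreal (\<rho> (y + \<eta> s) powr (- (1/2))) \<partial>\<mu>)
        \<le> ennreal (C2 * norm y powr \<alpha>)"
        using ne0
      proof eventually_elim
        case (elim y)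
        have "ennreal (norm y powr ((p - 1) * (1 + e))) * (\<integral>\<^sup>+s. ennreal (\<rho> (y + \<eta> s) powr (- (1/2))) \<partial>\<mu>)
          \<le> ennreal (norm y powr ((p - 1) * (1 + e))) * ennreal (C2 * norm y powr (- (1/2)))"
          using C2(2) elim by (intro mult_left_mono) auto
        also have "\<dots> = ennreal (C2 * (norm y powr (p - 1/2) * norm y powr (- (1/2))))"
          using C2(1) unfolding pe by (subst ennreal_mult[symmetric]) (auto simp: mult_ac)
        also have "norm y powr (p - 1/2) * norm y powr (- (1/2)) = norm y powr \<alpha>"
          using 4 by (simp flip: powr_add)
        finally show ?case .
      qed
      show "AE x in lborel. 0 < \<rho> x powr (- (1/2)) \<and> 0 < norm x powr \<alpha> \<and>
          (AE s in \<mu>. 0 < norm (x - \<eta> s) powr ((p - 1) * (1 + e)))"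
        using ne0 AE_\<rho>_pos[OF dim diff] by eventually_elim (use AE_\<mu>_neq_\<eta> in auto)
    qed (use C1 C2 p in auto)
  qed
qed

end

section \<open>Local geometry of curves with independent first two derivatives\<close>

lemma mvt_interval:
  fixes \<phi> \<phi>' :: "real \<Rightarrow> real"
  assumes S: "is_interval S" and d: "\<And>z. z \<in> S \<Longrightarrow> (\<phi> has_real_derivative \<phi>' z) (at z)"
    and xy: "x \<in> S" "y \<in> S"
  shows "\<exists>z\<in>S. \<phi> x - \<phi> y = (x - y) * \<phi>' z"
proof -
  have *: "\<exists>z\<in>S. \<phi> b - \<phi> a = (b - a) * \<phi>' z" if "a < b" "a \<in> S" "b \<in> S" for a b
  proof -
    have S': "z \<in> S" if "a \<le> z" "z \<le> b" for z
      using S \<open>a \<in> S\<close> \<open>b \<in> S\<close> that unfolding is_interval_1 by blast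
    from MVT2[OF \<open>a < b\<close>, of \<phi> \<phi>'] d S' obtain z where "a < z" "z < b" "\<phi> b - \<phi> a = (b - a) * \<phi>' z"
      by blast
    with S' show ?thesis by (intro bexI[of _ z]) auto
  qed
  consider "x < y" | "x = y" | "y < x" by linarith
  then show ?thesis
  proof cases
    case 1
    with * xy obtain z where "z \<in> S" "\<phi> y - \<phi> x = (y - x) * \<phi>' z" by blast
    then show ?thesis by (intro bexI[of _ z]) (auto simp: algebra_simps)
  qed (use * xy in auto)
qed

lemma second_difference_mvt:
  fixes \<phi> \<phi>' \<phi>'' :: "real \<Rightarrow> real"
  assumes S: "is_interval S" and d1: "\<And>z. z \<in> S \<Longrightarrow> (\<phi> has_real_derivative \<phi>' z) (at z)"
    and d2: "\<And>z. z \<in> S \<Longrightarrow> (\<phi>' has_real_derivative \<phi>'' z) (at z)"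
    and xy: "x \<in> S" "y \<in> S" "x - h \<in> S" "y - h \<in> S"
  shows "\<exists>z\<in>S. \<phi> x - \<phi> (x - h) - (\<phi> y - \<phi> (y - h)) = (x - y) * h * \<phi>'' z"
proof -
  define S' where "S' = {z \<in> S. z - h \<in> S}"
  have S': "is_interval S'"
    unfolding is_interval_1 S'_def
  proof (clarsimp, intro conjI)
    fix a b x assume "a \<in> S" "a - h \<in> S" "b \<in> S" "b - h \<in> S" "a \<le> x" "x \<le> b"
    then show "x \<in> S" "x - h \<in> S" using S unfolding is_interval_1 by (blast, meson diff_right_mono)
  qed
  have "\<exists>z\<in>S'. (\<phi> x - \<phi> (x - h)) - (\<phi> y - \<phi> (y - h)) = (x - y) * (\<phi>' z - \<phi>' (z - h))"
  proof (rule mvt_interval[OF S', of "\<lambda>z. \<phi> z - \<phi> (z - h)"])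
    fix z assume z: "z \<in> S'"
    have "((\<lambda>z. \<phi> (z - h)) has_real_derivative \<phi>' (z - h) * 1) (at z)"
      by (rule DERIV_chain'[where f = "\<lambda>z. z - h"])
        (use d1[of "z - h"] z in \<open>auto simp: S'_def intro!: derivative_eq_intros\<close>)
    then show "((\<lambda>z. \<phi> z - \<phi> (z - h)) has_real_derivative \<phi>' z - \<phi>' (z - h)) (at z)"
      using z d1[of z] by (intro DERIV_diff) (auto simp: S'_def)
  qed (use xy in \<open>auto simp: S'_def\<close>)
  then obtain z where z: "z \<in> S" "z - h \<in> S"
    "(\<phi> x - \<phi> (x - h)) - (\<phi> y - \<phi> (y - h)) = (x - y) * (\<phi>' z - \<phi>' (z - h))"
    by (auto simp: S'_def)
  from mvt_interval[OF S d2 z(1,2)] obtain w where w: "w \<in> S" "\<phi>' z - \<phi>' (z - h) = (z - (z - h)) * \<phi>'' w"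
    by blast
  with z show ?thesis by (intro bexI[of _ w]) (auto simp: mult_ac)
qed

text \<open>The dual vectors \<open>u\<close> and \<open>v\<close> reduce everything to mean value theorems for scalar functions.\<close>

lemma curved_arc_local:
  fixes \<gamma> \<gamma>1 \<gamma>2 :: "real \<Rightarrow> 'a::euclidean_space"
  assumes U: "open U" "s0 \<in> U"
    and d1: "\<And>s. s \<in> U \<Longrightarrow> (\<gamma> has_vector_derivative \<gamma>1 s) (at s)"
    and d2: "\<And>s. s \<in> U \<Longrightarrow> (\<gamma>1 has_vector_derivative \<gamma>2 s) (at s)"
    and cont2: "continuous_on U \<gamma>2"
    and u: "u \<bullet> \<gamma>1 s0 = 1" "u \<bullet> \<gamma>2 s0 = 0" and v: "v \<bullet> \<gamma>1 s0 = 0" "v \<bullet> \<gamma>2 s0 = 1"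
  obtains r c L where "0 < r" "{s0 - r..s0 + r} \<subseteq> U" "curved_arc {s0 - r..s0 + r} \<gamma> c L (2 * r)"
proof -
  have c1: "continuous (at s0) \<gamma>1" using d2 U by (blast intro: has_vector_derivative_continuous)
  have c2: "continuous (at s0) \<gamma>2" using cont2 U by (simp add: continuous_on_eq_continuous_at)
  have lim: "\<gamma>1 \<midarrow>s0\<rightarrow> \<gamma>1 s0" "\<gamma>2 \<midarrow>s0\<rightarrow> \<gamma>2 s0" using c1 c2 by (auto simp: isCont_def)
  have near: "\<forall>\<^sub>F s in at s0. \<bar>w \<bullet> \<Gamma> s - w \<bullet> \<Gamma> s0\<bar> < 1/4" if "\<Gamma> \<midarrow>s0\<rightarrow> \<Gamma> s0" for w and \<Gamma> :: "real \<Rightarrow> 'a"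
    using tendstoD[OF tendsto_inner[OF tendsto_const that, of w], of "1/4"] by (simp add: dist_real_def)
  have "\<forall>\<^sub>F s in at s0. s \<in> U \<and> norm (\<gamma>1 s) < norm (\<gamma>1 s0) + 1 \<and>
      \<bar>u \<bullet> \<gamma>1 s - 1\<bar> < 1/4 \<and> \<bar>u \<bullet> \<gamma>2 s\<bar> < 1/4 \<and> \<bar>v \<bullet> \<gamma>1 s\<bar> < 1/4 \<and> \<bar>v \<bullet> \<gamma>2 s - 1\<bar> < 1/4"
    using near[OF lim(1), of u] near[OF lim(2), of u] near[OF lim(1), of v] near[OF lim(2), of v]
      order_tendstoD(2)[OF tendsto_norm[OF lim(1)], of "norm (\<gamma>1 s0) + 1"] eventually_at_in_open'[OF U]
    by (auto simp: u v intro!: eventually_conj)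
  then obtain \<delta> where \<delta>: "0 < \<delta>" "\<And>s. s \<noteq> s0 \<Longrightarrow> dist s s0 < \<delta> \<Longrightarrow> s \<in> U \<and> norm (\<gamma>1 s) < norm (\<gamma>1 s0) + 1 \<and>
      \<bar>u \<bullet> \<gamma>1 s - 1\<bar> < 1/4 \<and> \<bar>u \<bullet> \<gamma>2 s\<bar> < 1/4 \<and> \<bar>v \<bullet> \<gamma>1 s\<bar> < 1/4 \<and> \<bar>v \<bullet> \<gamma>2 s - 1\<bar> < 1/4"
    unfolding eventually_at by blast
  define S where "S = ball s0 \<delta>"
  have S: "is_interval S" "convex S" unfolding S_def by (auto simp: is_interval_ball_real)
  have S_bounds: "s \<in> U" "norm (\<gamma>1 s) \<le> norm (\<gamma>1 s0) + 1" "\<bar>u \<bullet> \<gamma>1 s - 1\<bar> \<le> 1/4" "\<bar>u \<bullet> \<gamma>2 s\<bar> \<le> 1/4"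
    "\<bar>v \<bullet> \<gamma>1 s\<bar> \<le> 1/4" "\<bar>v \<bullet> \<gamma>2 s - 1\<bar> \<le> 1/4" if "s \<in> S" for s
    using \<delta>(2)[of s] that U(2) u v by (cases "s = s0"; force simp: S_def dist_commute)+
  define r where "r = \<delta> / 4"
  define J where "J = {s0 - r..s0 + r}"
  have r: "0 < r" using \<delta> by (simp add: r_def)
  have JS: "s \<in> S" if "s \<in> J" for s using that \<delta> by (auto simp: J_def S_def r_def dist_real_def)
  have dw1: "((\<lambda>s. w \<bullet> \<gamma> s) has_real_derivative w \<bullet> \<gamma>1 s) (at s)" if "s \<in> S" for w s
    using bounded_linear.has_vector_derivative[OF bounded_linear_inner_right d1[OF S_bounds(1)[OF that]], of w]
    by (simp add: has_real_derivative_iff_has_vector_derivative)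
  have dw2: "((\<lambda>s. w \<bullet> \<gamma>1 s) has_real_derivative w \<bullet> \<gamma>2 s) (at s)" if "s \<in> S" for w s
    using bounded_linear.has_vector_derivative[OF bounded_linear_inner_right d2[OF S_bounds(1)[OF that]], of w]
    by (simp add: has_real_derivative_iff_has_vector_derivative)
  define c where "c = 1 / (2 * (norm u + norm v))"
  have u0: "0 < norm u" using u by auto
  then have uv: "0 < norm u + norm v" by (simp add: add_pos_nonneg)
  have c: "0 < c" using uv by (simp add: c_def)
  have c_le: "c * X \<le> norm w" if "X / 2 \<le> (norm u + norm v) * norm w" for X and w :: 'a
    using that uv by (simp add: c_def field_simps)
  have "curved_arc J \<gamma> c (norm (\<gamma>1 s0) + 1) (2 * r)"
  proof
    show "compact J" "J \<noteq> {}" "0 < c" "0 \<le> norm (\<gamma>1 s0) + 1" "0 < 2 * r"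
      using r c by (auto simp: J_def)
    fix s s' assume s: "s \<in> J" "s' \<in> J"
    then show "\<bar>s - s'\<bar> \<le> 2 * r" by (auto simp: J_def abs_if)
    have "norm (\<gamma> s - \<gamma> s') \<le> (norm (\<gamma>1 s0) + 1) * norm (s - s')"
    proof (rule differentiable_bound[OF S(2)])
      fix x assume x: "x \<in> S"
      show "(\<gamma> has_derivative (\<lambda>h. h *\<^sub>R \<gamma>1 x)) (at x within S)"
        using d1[OF S_bounds(1)[OF x]] by (auto simp: has_vector_derivative_def intro: has_derivative_at_withinI)
      show "onorm (\<lambda>h. h *\<^sub>R \<gamma>1 x) \<le> norm (\<gamma>1 s0) + 1"
        by (rule onorm_le) (use S_bounds(2)[OF x] in \<open>simp add: mult.commute mult_left_mono\<close>)
    qed (use JS s in auto)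
    then show "norm (\<gamma> s - \<gamma> s') \<le> (norm (\<gamma>1 s0) + 1) * \<bar>s - s'\<bar>" by simp
    obtain z where z: "z \<in> S" "u \<bullet> \<gamma> s - u \<bullet> \<gamma> s' = (s - s') * (u \<bullet> \<gamma>1 z)"
      using mvt_interval[OF S(1) dw1 JS[OF s(1)] JS[OF s(2)], of u] by blast
    have "\<bar>s - s'\<bar> * (1/2) \<le> \<bar>s - s'\<bar> * \<bar>u \<bullet> \<gamma>1 z\<bar>"
      by (rule mult_left_mono) (use S_bounds(3)[OF z(1)] in linarith)+
    also have "\<dots> = \<bar>u \<bullet> (\<gamma> s - \<gamma> s')\<bar>" using z by (simp add: inner_diff_right abs_mult)
    also have "\<dots> \<le> norm u * norm (\<gamma> s - \<gamma> s')" by (rule Cauchy_Schwarz_ineq2)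
    also have "\<dots> \<le> (norm u + norm v) * norm (\<gamma> s - \<gamma> s')" by (intro mult_right_mono) auto
    finally show "c * \<bar>s - s'\<bar> \<le> norm (\<gamma> s - \<gamma> s')" by (intro c_le) simp
  next
    fix s1 s1' s2 s2' assume s: "s1 \<in> J" "s1' \<in> J" "s2 \<in> J" "s2' \<in> J"
    define h where "h = s1 - s1'"
    define X where "X = \<gamma> s1 - \<gamma> s1' - (\<gamma> s2 - \<gamma> s2')"
    define A where "A = \<bar>(s1 - s2) * h\<bar>"
    define B where "B = \<bar>s2' - (s2 - h)\<bar>"
    have S': "s1 \<in> S" "s2 \<in> S" "s2' \<in> S" "s1 - h \<in> S" "s2 - h \<in> S"
      using s JS \<delta>(1) by (auto simp: h_def) (auto simp: S_def J_def r_def dist_real_def abs_if)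
    have split: "\<exists>z1\<in>S. \<exists>z2\<in>S. w \<bullet> X = (s1 - s2) * h * (w \<bullet> \<gamma>2 z1) + (s2' - (s2 - h)) * (w \<bullet> \<gamma>1 z2)" for w
    proof -
      obtain z1 where z1: "z1 \<in> S"
        "w \<bullet> \<gamma> s1 - w \<bullet> \<gamma> (s1 - h) - (w \<bullet> \<gamma> s2 - w \<bullet> \<gamma> (s2 - h)) = (s1 - s2) * h * (w \<bullet> \<gamma>2 z1)"
        using second_difference_mvt[OF S(1) dw1 dw2 S'(1,2,4,5), of w] by blast
      obtain z2 where z2: "z2 \<in> S" "w \<bullet> \<gamma> s2' - w \<bullet> \<gamma> (s2 - h) = (s2' - (s2 - h)) * (w \<bullet> \<gamma>1 z2)"
        using mvt_interval[OF S(1) dw1 S'(3,5), of w] by blast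
      have "w \<bullet> X = (w \<bullet> \<gamma> s1 - w \<bullet> \<gamma> (s1 - h) - (w \<bullet> \<gamma> s2 - w \<bullet> \<gamma> (s2 - h))) + (w \<bullet> \<gamma> s2' - w \<bullet> \<gamma> (s2 - h))"
        by (simp add: X_def h_def inner_diff_right)
      with z1 z2 show ?thesis by metis
    qed
    have lower: "\<bar>a * x\<bar> \<ge> \<bar>a\<bar> * (3/4)" if "\<bar>x - 1\<bar> \<le> 1/4" for a x :: real
      unfolding abs_mult by (rule mult_left_mono) (use that in linarith)+
    have upper: "\<bar>a * x\<bar> \<le> \<bar>a\<bar> * (1/4)" if "\<bar>x\<bar> \<le> 1/4" for a x :: real
      unfolding abs_mult using that by (intro mult_left_mono) auto
    have "B * (3/4) - A * (1/4) \<le> \<bar>u \<bullet> X\<bar>"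
    proof -
      obtain z1 z2 where z: "z1 \<in> S" "z2 \<in> S"
        "u \<bullet> X = (s1 - s2) * h * (u \<bullet> \<gamma>2 z1) + (s2' - (s2 - h)) * (u \<bullet> \<gamma>1 z2)" using split by blast
      show ?thesis
        using lower[OF S_bounds(3)[OF z(2)], of "s2' - (s2 - h)"] upper[OF S_bounds(4)[OF z(1)], of "(s1 - s2) * h"] z(3)
        unfolding A_def B_def by linarith
    qed
    moreover have "A * (3/4) - B * (1/4) \<le> \<bar>v \<bullet> X\<bar>"
    proof -
      obtain z1 z2 where z: "z1 \<in> S" "z2 \<in> S"
        "v \<bullet> X = (s1 - s2) * h * (v \<bullet> \<gamma>2 z1) + (s2' - (s2 - h)) * (v \<bullet> \<gamma>1 z2)" using split by blast
      show ?thesis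
        using lower[OF S_bounds(6)[OF z(1)], of "(s1 - s2) * h"] upper[OF S_bounds(5)[OF z(2)], of "s2' - (s2 - h)"] z(3)
        unfolding A_def B_def by linarith
    qed
    moreover have "\<bar>u \<bullet> X\<bar> \<le> norm u * norm X" "\<bar>v \<bullet> X\<bar> \<le> norm v * norm X"
      by (rule Cauchy_Schwarz_ineq2)+
    moreover have "0 \<le> B" by (simp add: B_def)
    ultimately have "A / 2 \<le> (norm u + norm v) * norm X" by (simp add: distrib_right)
    then have "c * A \<le> norm X" by (rule c_le)
    then show "c * (\<bar>s1 - s1'\<bar> * \<bar>s1 - s2\<bar>) \<le> norm (\<gamma> s1 - \<gamma> s1' - (\<gamma> s2 - \<gamma> s2'))"
      by (simp add: A_def h_def X_def abs_mult mult.commute)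
  qed
  moreover have "J \<subseteq> U" using JS S_bounds(1) by blast
  ultimately show thesis using r that unfolding J_def by blast
qed

section \<open>Averages of Lebesgue measurable functions\<close>

lemma lebesgue_ex_borel_complex:
  fixes f :: "'a::euclidean_space \<Rightarrow> complex"
  assumes f: "f \<in> borel_measurable lebesgue"
  obtains f' where "f' \<in> borel_measurable borel" "AE x in lborel. f x = f' x"
proof -
  have "(\<lambda>x. Re (f x)) \<in> borel_measurable lebesgue" "(\<lambda>x. Im (f x)) \<in> borel_measurable lebesgue"
    using f by measurable
  from this[THEN completion_ex_borel_measurable_real] obtain a b
    where ab[measurable]: "a \<in> borel_measurable borel" "b \<in> borel_measurable borel"
      and eq: "AE x in lborel. Re (f x) = a x" "AE x in lborel. Im (f x) = b x" by auto
  show thesis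
  proof
    show "(\<lambda>x. of_real (a x) + \<i> * of_real (b x)) \<in> borel_measurable borel" by measurable
    show "AE x in lborel. f x = of_real (a x) + \<i> * of_real (b x)"
      using eq by eventually_elim (simp add: complex_eq_iff)
  qed
qed

lemma AE_translates:
  fixes \<eta> :: "'b \<Rightarrow> 'a::euclidean_space"
  assumes "sigma_finite_measure \<mu>" and [measurable]: "\<eta> \<in> borel_measurable \<mu>"
    and ae: "AE y in lborel. P y"
  shows "AE x in lborel. AE s in \<mu>. P (x - \<eta> s)"
proof -
  interpret \<mu>: sigma_finite_measure \<mu> by fact
  interpret pair_sigma_finite \<mu> "lborel :: 'a measure" ..
  from ae obtain N where N: "{y. \<not> P y} \<subseteq> N" "N \<in> sets borel" "emeasure lborel N = 0"
    by (auto elim!: AE_E)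
  note [measurable] = N(2)
  have "(\<integral>\<^sup>+x. \<integral>\<^sup>+s. indicator N (x - \<eta> s) \<partial>\<mu> \<partial>lborel) = (\<integral>\<^sup>+s. \<integral>\<^sup>+x. indicator N (x - \<eta> s) \<partial>lborel \<partial>\<mu>)"
    by (rule Fubini') measurable
  also have "\<dots> = 0"
    using N(2,3) by (subst nn_integral_lborel_translate) auto
  finally have "AE x in lborel. (\<integral>\<^sup>+s. indicator N (x - \<eta> s) \<partial>\<mu>) = 0"
    by (subst (asm) nn_integral_0_iff_AE) auto
  then show ?thesis
  proof eventually_elim
    case (elim x)
    then have "AE s in \<mu>. (indicator N (x - \<eta> s) :: ennreal) = 0"
      by (subst (asm) nn_integral_0_iff_AE) auto
    then show ?case
      by eventually_elim (use N(1) in \<open>auto simp: indicator_def split: if_splits\<close>)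
  qed
qed

lemma averages_bounded_imp_bochner:
  fixes \<eta> :: "real \<Rightarrow> 'a::euclidean_space" and chi :: "real \<Rightarrow> real"
  defines "A \<equiv> \<lambda>f x. LINT s|lebesgue. f (x - \<eta> s) * complex_of_real (chi s)"
  assumes b: "averages_bounded p \<omega> (density lborel (\<lambda>s. ennreal (chi s))) \<eta>"
    and [measurable]: "\<eta> \<in> borel_measurable borel" "chi \<in> borel_measurable borel" "\<omega> \<in> borel_measurable borel"
    and chi: "\<And>s. 0 \<le> chi s" and \<omega>: "\<And>x. 0 \<le> \<omega> x" and p: "0 \<le> p"
  obtains C where "0 \<le> C"
    "\<And>f. f \<in> borel_measurable lebesgue \<Longrightarrow> integrable lebesgue (\<lambda>x. norm (f x) powr p * \<omega> x) \<Longrightarrow>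
      (AE x in lebesgue. integrable lebesgue (\<lambda>s. f (x - \<eta> s) * complex_of_real (chi s))) \<and>
      A f \<in> borel_measurable lebesgue \<and> integrable lebesgue (\<lambda>x. norm (A f x) powr p * \<omega> x) \<and>
      (LINT x|lebesgue. norm (A f x) powr p * \<omega> x) \<le> C * (LINT x|lebesgue. norm (f x) powr p * \<omega> x)"
proof -
  let ?\<mu> = "density lborel (\<lambda>s. ennreal (chi s))"
  from b obtain C where C: "0 \<le> C" and CG: "\<And>g. g \<in> borel_measurable borel \<Longrightarrow> (\<And>x. 0 \<le> g x) \<Longrightarrow>
     (\<integral>\<^sup>+x. ennreal (g x powr p * \<omega> x) \<partial>lborel) < \<infinity> \<Longrightarrow>
     \<exists>G\<in>borel_measurable borel. (\<forall>x. 0 \<le> G x) \<and>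
        (AE x in lborel. (\<integral>\<^sup>+s. ennreal (g (x - \<eta> s)) \<partial>?\<mu>) \<le> ennreal (G x)) \<and>
        (\<integral>\<^sup>+x. ennreal (G x powr p * \<omega> x) \<partial>lborel)
          \<le> ennreal C * (\<integral>\<^sup>+x. ennreal (g x powr p * \<omega> x) \<partial>lborel)"
    unfolding averages_bounded_def by blast
  show thesis
  proof (rule that[OF C])
    fix f :: "'a \<Rightarrow> complex"
    assume f: "f \<in> borel_measurable lebesgue" and int: "integrable lebesgue (\<lambda>x. norm (f x) powr p * \<omega> x)"
    obtain f' where [measurable]: "f' \<in> borel_measurable borel" and ff': "AE x in lborel. f x = f' x"
      by (rule lebesgue_ex_borel_complex[OF f])
    define N where "N = (LINT x|lebesgue. norm (f x) powr p * \<omega> x)"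
    have N0: "0 \<le> N" unfolding N_def using \<omega> by (intro integral_nonneg_AE) auto
    have "(\<integral>\<^sup>+x. ennreal (norm (f' x) powr p * \<omega> x) \<partial>lborel) = (\<integral>\<^sup>+x. ennreal (norm (f x) powr p * \<omega> x) \<partial>lborel)"
      using ff' by (intro nn_integral_cong_AE) auto
    also have "\<dots> = (\<integral>\<^sup>+x. ennreal (norm (f x) powr p * \<omega> x) \<partial>lebesgue)"
      by (simp add: nn_integral_completion)
    also have "\<dots> = ennreal N"
      unfolding N_def using \<omega> by (intro nn_integral_eq_integral int) auto
    finally have N: "(\<integral>\<^sup>+x. ennreal (norm (f' x) powr p * \<omega> x) \<partial>lborel) = ennreal N" .
    then obtain G where [measurable]: "G \<in> borel_measurable borel" and G0: "\<And>x. 0 \<le> G x"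
      and G: "AE x in lborel. (\<integral>\<^sup>+s. ennreal (norm (f' (x - \<eta> s))) \<partial>?\<mu>) \<le> ennreal (G x)"
      and GN: "(\<integral>\<^sup>+x. ennreal (G x powr p * \<omega> x) \<partial>lborel) \<le> ennreal C * ennreal N"
      using CG[of "\<lambda>x. norm (f' x)"] by auto
    define F where "F x = (LINT s|lborel. f' (x - \<eta> s) * complex_of_real (chi s))" for x
    have F[measurable]: "F \<in> borel_measurable borel" unfolding F_def by measurable
    have "AE x in lborel. AE s in lborel. f (x - \<eta> s) = f' (x - \<eta> s)"
      by (rule AE_translates) (use ff' in \<open>auto intro: lborel.sigma_finite_measure_axioms\<close>)
    with G have key: "AE x in lborel. integrable lebesgue (\<lambda>s. f (x - \<eta> s) * complex_of_real (chi s)) \<and>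
        A f x = F x \<and> norm (F x) \<le> G x"
    proof eventually_elim
      case (elim x)
      let ?h = "\<lambda>s. f (x - \<eta> s) * complex_of_real (chi s)"
      let ?k = "\<lambda>s. f' (x - \<eta> s) * complex_of_real (chi s)"
      have [measurable]: "?k \<in> borel_measurable borel" by measurable
      have km: "?k \<in> borel_measurable lebesgue" by (rule measurable_completion) simp
      have "AE s in lebesgue. ?k s = ?h s"
        by (rule AE_completion) (use elim(2) in \<open>eventually_elim, simp\<close>)
      note eq = this
      have hm: "?h \<in> borel_measurable lebesgue" by (rule borel_measurable_AE[OF km eq])
      have "(\<integral>\<^sup>+s. ennreal (norm (?k s)) \<partial>lborel) = (\<integral>\<^sup>+s. ennreal (norm (f' (x - \<eta> s))) \<partial>?\<mu>)"
        by (subst nn_integral_density) (auto simp: norm_mult chi ennreal_mult' mult.commute)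
      with elim(1) have le: "(\<integral>\<^sup>+s. ennreal (norm (?k s)) \<partial>lborel) \<le> ennreal (G x)" by simp
      then have ik: "integrable lborel ?k"
        unfolding integrable_iff_bounded by (auto intro: le_less_trans)
      then have "integrable lebesgue ?k" by (simp add: integrable_completion)
      then have "integrable lebesgue ?h" by (rule integrable_cong_AE_imp[OF _ hm eq])
      moreover have "A f x = F x"
        unfolding A_def F_def using eq by (subst integral_cong_AE[OF hm km]) (auto simp: integral_completion)
      moreover have "norm (F x) \<le> G x"
      proof -
        have "ennreal (norm (F x)) \<le> ennreal (G x)"
          unfolding F_def by (rule order_trans[OF integral_norm_bound_ennreal[OF ik] le])
        then show ?thesis using G0 by simp
      qed
      ultimately show ?case by blast
    qed
    have AF: "AE x in lebesgue. F x = A f x" using key by (intro AE_completion) auto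
    have Am: "A f \<in> borel_measurable lebesgue"
      by (rule borel_measurable_AE[OF _ AF]) (simp add: measurable_completion)
    have Apm: "(\<lambda>x. norm (A f x) powr p * \<omega> x) \<in> borel_measurable lebesgue"
    proof -
      have [measurable]: "\<omega> \<in> borel_measurable lebesgue" by (simp add: measurable_completion)
      show ?thesis using Am by measurable
    qed
    have "(\<integral>\<^sup>+x. ennreal (norm (A f x) powr p * \<omega> x) \<partial>lebesgue)
      \<le> (\<integral>\<^sup>+x. ennreal (G x powr p * \<omega> x) \<partial>lebesgue)"
    proof (rule nn_integral_mono_AE, rule AE_completion)
      show "AE x in lborel. ennreal (norm (A f x) powr p * \<omega> x) \<le> ennreal (G x powr p * \<omega> x)"
        using key by eventually_elim (use \<omega> p in \<open>auto intro!: ennreal_leI mult_right_mono powr_mono2\<close>)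
    qed
    also have "\<dots> = (\<integral>\<^sup>+x. ennreal (G x powr p * \<omega> x) \<partial>lborel)" by (simp add: nn_integral_completion)
    also have "\<dots> \<le> ennreal (C * N)" using GN C N0 by (simp add: ennreal_mult)
    finally have A_le: "(\<integral>\<^sup>+x. ennreal (norm (A f x) powr p * \<omega> x) \<partial>lebesgue) \<le> ennreal (C * N)" .
    then have Ai: "integrable lebesgue (\<lambda>x. norm (A f x) powr p * \<omega> x)"
      using Apm \<omega> by (intro integrableI_bounded) (auto intro: le_less_trans)
    have "ennreal (LINT x|lebesgue. norm (A f x) powr p * \<omega> x) \<le> ennreal (C * N)"
      using A_le \<omega> by (subst nn_integral_eq_integral[OF Ai, symmetric]) auto
    then have "(LINT x|lebesgue. norm (A f x) powr p * \<omega> x) \<le> C * N"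
      using C N0 by (simp add: ennreal_le_iff)
    moreover have "AE x in lebesgue. integrable lebesgue (\<lambda>s. f (x - \<eta> s) * complex_of_real (chi s))"
      using key by (intro AE_completion) auto
    ultimately show "(AE x in lebesgue. integrable lebesgue (\<lambda>s. f (x - \<eta> s) * complex_of_real (chi s))) \<and>
      A f \<in> borel_measurable lebesgue \<and> integrable lebesgue (\<lambda>x. norm (A f x) powr p * \<omega> x) \<and>
      (LINT x|lebesgue. norm (A f x) powr p * \<omega> x) \<le> C * (LINT x|lebesgue. norm (f x) powr p * \<omega> x)"
      using Am Ai unfolding N_def by blast
  qed
qed

section \<open>Non-degenerate curves\<close>

lemma smooth_on_has_vector_derivative:
  assumes "smooth_on I \<gamma>" "s \<in> interior I"
  shows "(nth_deriv_within I k \<gamma> has_vector_derivative nth_deriv_within I (Suc k) \<gamma> s) (at s)"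
proof -
  have "s \<in> I" using assms(2) interior_subset by blast
  then have "nth_deriv_within I k \<gamma> differentiable at s within I"
    using assms(1) unfolding smooth_on_def differentiable_on_def by blast
  then show ?thesis
    by (simp add: vector_derivative_works at_within_interior[OF assms(2)])
qed

lemma det_nonzero_dual_vectors:
  fixes a b d :: "real ^ 3"
  assumes "det (vector [a, b, d] :: real ^ 3 ^ 3) \<noteq> 0"
  obtains u v :: "real ^ 3" where "u \<bullet> a = 1" "u \<bullet> b = 0" "v \<bullet> a = 0" "v \<bullet> b = 1"
proof -
  let ?M = "vector [a, b, d] :: real ^ 3 ^ 3"
  from assms have "invertible ?M" by (simp add: invertible_det_nz)
  then obtain N where N: "?M ** N = mat 1" by (auto simp: invertible_def)
  have *: "column j N \<bullet> (?M $ i) = (if i = j then 1 else 0)" for i j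
  proof -
    have "column j N \<bullet> (?M $ i) = (?M ** N) $ i $ j"
      by (simp add: matrix_matrix_mult_def inner_vec_def column_def mult.commute)
    then show ?thesis by (simp add: N mat_def)
  qed
  show thesis
    using that[of "column 1 N" "column 2 N"] *[of 1 1] *[of 1 2] *[of 2 1] *[of 2 2]
    by (simp add: vector_3)
qed

lemma curved_arc_cong:
  assumes "curved_arc J \<eta> c L D" "\<And>s. s \<in> J \<Longrightarrow> \<eta>' s = \<eta> s"
  shows "curved_arc J \<eta>' c L D"
  using assms unfolding curved_arc_def by (simp cong: conj_cong)

lemma nondegenerate_averages_bounded:
  fixes I :: "real set" and \<gamma> :: "real \<Rightarrow> real ^ 3" and chi :: "real \<Rightarrow> real"
  assumes smooth: "smooth_on I \<gamma>" and nondeg: "nondegenerate_on I \<gamma>"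
    and bump: "bump_function_in (interior I) chi"
    and p: "1 < p" and \<alpha>: "-1 \<le> \<alpha>" "\<alpha> \<le> p - 1" and t: "0 < t"
  obtains \<eta> where "\<eta> \<in> borel_measurable borel" "\<And>s. chi s \<noteq> 0 \<Longrightarrow> \<eta> s = t *\<^sub>R \<gamma> s"
    "averages_bounded p (\<lambda>x. norm x powr \<alpha>) (density lborel (\<lambda>s. ennreal (chi s))) \<eta>"
proof -
  define U where "U = interior I"
  define S where "S = closure {s. chi s \<noteq> 0}"
  have U: "open U" "U \<subseteq> I" by (auto simp: U_def interior_subset)
  have S: "compact S" "S \<subseteq> U" and chi0: "\<And>s. 0 \<le> chi s" and chi_smooth: "smooth_on UNIV chi"
    using bump by (auto simp: bump_function_in_def S_def U_def)
  have "chi differentiable_on UNIV" using chi_smooth[unfolded smooth_on_def, rule_format, of 0] by simp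
  then have chi_cont: "continuous_on UNIV chi" by (rule differentiable_imp_continuous_on)
  have chi_S: "chi s = 0" if "s \<notin> S" for s using that closure_subset[of "{s. chi s \<noteq> 0}"] by (auto simp: S_def)
  define \<Gamma> where "\<Gamma> k s = t *\<^sub>R nth_deriv_within I k \<gamma> s" for k s
  have \<Gamma>0: "\<Gamma> 0 s = t *\<^sub>R \<gamma> s" for s by (simp add: \<Gamma>_def)
  have d: "(\<Gamma> k has_vector_derivative \<Gamma> (Suc k) s) (at s)" if "s \<in> U" for k s
    using smooth_on_has_vector_derivative[OF smooth, of s k] that unfolding \<Gamma>_def U_def
    by (intro has_vector_derivative_scaleR[where f = "\<lambda>_. t" and f' = 0, simplified]) auto
  have cont: "continuous_on U (\<Gamma> k)" for k
    using d by (intro continuous_at_imp_continuous_on ballI) (blast intro: has_vector_derivative_continuous)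
  have "\<exists>r c L. 0 < r \<and> {s - r..s + r} \<subseteq> U \<and> curved_arc {s - r..s + r} (\<Gamma> 0) c L (2 * r)" if s: "s \<in> S" for s
  proof -
    have sU: "s \<in> U" using s S by blast
    from nondeg obtain c0 where "0 < c0" "\<forall>s\<in>I. \<bar>det (vector [nth_deriv_within I 1 \<gamma> s,
        nth_deriv_within I 2 \<gamma> s, nth_deriv_within I 3 \<gamma> s] :: real ^ 3 ^ 3)\<bar> \<ge> c0"
      unfolding nondegenerate_on_def by blast
    then have "det (vector [nth_deriv_within I 1 \<gamma> s,
        nth_deriv_within I 2 \<gamma> s, nth_deriv_within I 3 \<gamma> s] :: real ^ 3 ^ 3) \<noteq> 0"
      using sU U by fastforce
    from det_nonzero_dual_vectors[OF this] obtain u v where uv: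
      "u \<bullet> nth_deriv_within I 1 \<gamma> s = 1" "u \<bullet> nth_deriv_within I 2 \<gamma> s = 0"
      "v \<bullet> nth_deriv_within I 1 \<gamma> s = 0" "v \<bullet> nth_deriv_within I 2 \<gamma> s = 1" by blast
    obtain r c L where "0 < r" "{s - r..s + r} \<subseteq> U" "curved_arc {s - r..s + r} (\<Gamma> 0) c L (2 * r)"
    proof (rule curved_arc_local[OF U(1) sU, of "\<Gamma> 0" "\<Gamma> 1" "\<Gamma> 2" "u /\<^sub>R t" "v /\<^sub>R t"])
      show "(\<Gamma> 0 has_vector_derivative \<Gamma> 1 s) (at s)" if "s \<in> U" for s using d[OF that, of 0] by simp
      show "(\<Gamma> 1 has_vector_derivative \<Gamma> 2 s) (at s)" if "s \<in> U" for s
        using d[OF that, of 1] by (simp add: numeral_2_eq_2)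
    qed (use uv t cont in \<open>auto simp: \<Gamma>_def simp del: nth_deriv_within.simps\<close>)
    then show ?thesis by blast
  qed
  then obtain r c L where r: "\<And>s. s \<in> S \<Longrightarrow> 0 < r s" "\<And>s. s \<in> S \<Longrightarrow> {s - r s..s + r s} \<subseteq> U"
    and arc: "\<And>s. s \<in> S \<Longrightarrow> curved_arc {s - r s..s + r s} (\<Gamma> 0) (c s) (L s) (2 * r s)" by metis
  obtain T where T: "T \<subseteq> S" "finite T" "S \<subseteq> (\<Union>s\<in>T. ball s (r s))"
    by (rule compactE_image[OF S(1), of S "\<lambda>s. ball s (r s)"]) (use r(1) in \<open>auto intro!: centre_in_ball[THEN iffD2]\<close>)
  define J where "J s = {s - r s..s + r s}" for s
  define K where "K = (\<Union>s\<in>T. J s)"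
  have "compact K" unfolding K_def J_def using T(2) by (intro compact_UN) auto
  then have K: "K \<in> sets borel" by (rule borel_compact)
  have KU: "K \<subseteq> U" using r(2) T(1) by (auto simp: K_def J_def)
  have "ball s (r s) \<subseteq> J s" for s by (auto simp: J_def dist_real_def abs_if split: if_splits)
  then have SK: "S \<subseteq> K" using T(3) unfolding K_def by blast
  \<comment> \<open>Nothing is known about \<open>\<gamma>\<close> outside \<open>I\<close>; truncation makes the curve Borel measurable.\<close>
  define \<eta> where "\<eta> s = (if s \<in> K then \<Gamma> 0 s else 0)" for s
  have \<eta>: "\<eta> \<in> borel_measurable borel"
    unfolding \<eta>_def using K continuous_on_subset[OF cont KU]
    by (intro borel_measurable_continuous_on_if) auto
  have \<eta>K: "\<eta> s = \<Gamma> 0 s" if "s \<in> K" for s using that by (simp add: \<eta>_def)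
  have piece: "averages_bounded p (\<lambda>x. norm x powr \<alpha>) (density lborel (indicator (J s))) \<eta>" if s: "s \<in> T" for s
  proof -
    have JK: "J s \<subseteq> K" using s by (auto simp: K_def)
    have "curved_arc (J s) \<eta> (c s) (L s) (2 * r s)"
      unfolding J_def by (rule curved_arc_cong[OF arc]) (use s T(1) JK \<eta>K in \<open>auto simp: J_def\<close>)
    then interpret curved_arc "J s" \<eta> "c s" "L s" "2 * r s" .
    have "\<eta> differentiable_on J s"
      unfolding differentiable_on_def
    proof
      fix x assume x: "x \<in> J s"
      then have "\<Gamma> 0 differentiable at x"
        using d[of x 0] JK KU by (blast intro: differentiableI_vector)
      then have "\<Gamma> 0 differentiable at x within J s" by (rule differentiable_at_withinI)
      then show "\<eta> differentiable at x within J s"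
        by (rule differentiable_transform_within[where d = 1]) (use x JK \<eta>K in auto)
    qed
    then show ?thesis
      by (intro averages_bounded_norm_powr \<eta> p \<alpha>) auto
  qed
  have "compact (chi ` S)" using chi_cont S(1) by (intro compact_continuous_image) (auto intro: continuous_on_subset)
  then obtain M where M: "0 < M" "\<And>s. s \<in> S \<Longrightarrow> chi s \<le> M"
    by (fastforce dest!: compact_imp_bounded simp: bounded_pos)
  have [measurable]: "chi \<in> borel_measurable borel" using chi_cont by (rule borel_measurable_continuous_onI)
  have [measurable]: "J s \<in> sets borel" for s by (simp add: J_def)
  have "averages_bounded p (\<lambda>x. norm x powr \<alpha>) (density lborel (\<lambda>s. ennreal (chi s))) \<eta>"
  proof (rule averages_bounded_sum[OF T(2) piece \<eta>])
    fix h :: "real \<Rightarrow> ennreal" assume [measurable]: "h \<in> borel_measurable borel"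
    have "(\<integral>\<^sup>+s. h s \<partial>density lborel (\<lambda>s. ennreal (chi s))) = (\<integral>\<^sup>+s. ennreal (chi s) * h s \<partial>lborel)"
      by (subst nn_integral_density) auto
    also have "\<dots> \<le> (\<integral>\<^sup>+s. ennreal M * (\<Sum>i\<in>T. indicator (J i) s * h s) \<partial>lborel)"
    proof (rule nn_integral_mono)
      fix s
      show "ennreal (chi s) * h s \<le> ennreal M * (\<Sum>i\<in>T. indicator (J i) s * h s)"
      proof (cases "s \<in> S")
        case True
        then obtain i where i: "i \<in> T" "s \<in> J i" using SK by (auto simp: K_def)
        have "ennreal (chi s) * h s \<le> ennreal M * (indicator (J i) s * h s)"
          using M(2)[OF True] i by (auto intro!: mult_right_mono ennreal_leI)
        also have "\<dots> \<le> ennreal M * (\<Sum>i\<in>T. indicator (J i) s * h s)"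
          using i T(2) by (intro mult_left_mono member_le_sum) auto
        finally show ?thesis .
      qed (simp add: chi_S)
    qed
    also have "\<dots> = ennreal M * (\<Sum>i\<in>T. \<integral>\<^sup>+s. indicator (J i) s * h s \<partial>lborel)"
      by (subst nn_integral_cmult, measurable) (subst nn_integral_sum, auto)
    also have "\<dots> = ennreal M * (\<Sum>i\<in>T. \<integral>\<^sup>+s. h s \<partial>density lborel (indicator (J i)))"
      by (simp add: nn_integral_density)
    finally show "(\<integral>\<^sup>+s. h s \<partial>density lborel (\<lambda>s. ennreal (chi s)))
      \<le> ennreal M * (\<Sum>i\<in>T. \<integral>\<^sup>+s. h s \<partial>density lborel (indicator (J i)))" .
  qed (use p M in auto)
  moreover have "\<eta> s = t *\<^sub>R \<gamma> s" if "chi s \<noteq> 0" for s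
  proof -
    have "s \<in> S" using chi_S that by blast
    then show ?thesis using SK \<eta>K \<Gamma>0 by auto
  qed
  ultimately show thesis using \<eta> that by blast
qed

theorem proposition1p2:
  fixes I :: "real set" and \<gamma> :: "real \<Rightarrow> real ^ 3" and chi :: "real \<Rightarrow> real" and p \<alpha> :: real
  assumes "is_interval I"
    and "smooth_on I \<gamma>"
    and "nondegenerate_on I \<gamma>"
    and "bump_function_in (interior I) chi"
    and "1 < p"
    and "-1 \<le> \<alpha>" and "\<alpha> \<le> p - 1"
  shows "\<forall>t>0.
    (\<forall>f\<in>weighted_Lp p \<alpha>. AE x in lebesgue.
        set_integrable lebesgue I (averaging_integrand \<gamma> chi t f x)) \<and>
    bounded_on_weighted_Lp p \<alpha> (averaging I \<gamma> chi t)"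
proof (intro allI impI)
  fix t :: real assume t: "0 < t"
  obtain \<eta> where \<eta>: "\<eta> \<in> borel_measurable borel" "\<And>s. chi s \<noteq> 0 \<Longrightarrow> \<eta> s = t *\<^sub>R \<gamma> s"
    "averages_bounded p (\<lambda>x. norm x powr \<alpha>) (density lborel (\<lambda>s. ennreal (chi s))) \<eta>"
    using nondegenerate_averages_bounded[OF assms(2-7) t] by blast
  have chi0: "0 \<le> chi s" for s using assms(4) by (simp add: bump_function_in_def)
  have chi_I: "s \<in> I" if "chi s \<noteq> 0" for s
    using assms(4) that closure_subset[of "{s. chi s \<noteq> 0}"] interior_subset[of I]
    by (auto simp: bump_function_in_def)
  have "chi differentiable_on UNIV"
    using assms(4) unfolding bump_function_in_def smooth_on_def by (metis nth_deriv_within.simps(1))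
  then have chi_meas: "chi \<in> borel_measurable borel"
    by (intro borel_measurable_continuous_onI differentiable_imp_continuous_on)
  have integrand: "indicator I s *\<^sub>R averaging_integrand \<gamma> chi t f x s = f (x - \<eta> s) * complex_of_real (chi s)"
    for f :: "real ^ 3 \<Rightarrow> complex" and x s
    using \<eta>(2)[of s] chi_I[of s] by (cases "chi s = 0") (auto simp: averaging_integrand_def indicator_def)
  define A where "A = (\<lambda>(f :: real ^ 3 \<Rightarrow> complex) x. LINT s|lebesgue. f (x - \<eta> s) * complex_of_real (chi s))"
  have A: "averaging I \<gamma> chi t f = A f" for f
    by (simp add: fun_eq_iff averaging_def A_def set_lebesgue_integral_def integrand)
  obtain C where C: "0 \<le> C" and
    CA: "\<And>f. f \<in> borel_measurable lebesgue \<Longrightarrow> integrable lebesgue (\<lambda>x. norm (f x) powr p * norm x powr \<alpha>) \<Longrightarrow>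
      (AE x in lebesgue. integrable lebesgue (\<lambda>s. f (x - \<eta> s) * complex_of_real (chi s))) \<and>
      A f \<in> borel_measurable lebesgue \<and> integrable lebesgue (\<lambda>x. norm (A f x) powr p * norm x powr \<alpha>) \<and>
      (LINT x|lebesgue. norm (A f x) powr p * norm x powr \<alpha>) \<le> C * (LINT x|lebesgue. norm (f x) powr p * norm x powr \<alpha>)"
    by (rule averages_bounded_imp_bochner[OF \<eta>(3,1) chi_meas _ chi0])
      (use assms(5) in \<open>auto intro: that[unfolded A_def]\<close>)
  have "weighted_Lp_norm p \<alpha> (A f) \<le> C powr (1 / p) * weighted_Lp_norm p \<alpha> f" if f: "f \<in> weighted_Lp p \<alpha>" for f
  proof -
    have "weighted_Lp_norm p \<alpha> (A f) \<le> (C * (LINT x|lebesgue. norm (f x) powr p * norm x powr \<alpha>)) powr (1 / p)"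
      unfolding weighted_Lp_norm_def using CA[of f] f assms(5)
      by (intro powr_mono2 integral_nonneg_AE) (auto simp: weighted_Lp_def)
    also have "\<dots> = C powr (1 / p) * weighted_Lp_norm p \<alpha> f"
      by (simp add: weighted_Lp_norm_def powr_mult)
    finally show ?thesis .
  qed
  then show "(\<forall>f\<in>weighted_Lp p \<alpha>. AE x in lebesgue.
        set_integrable lebesgue I (averaging_integrand \<gamma> chi t f x)) \<and>
    bounded_on_weighted_Lp p \<alpha> (averaging I \<gamma> chi t)"
    unfolding bounded_on_weighted_Lp_def A set_integrable_def integrand
    using CA by (auto simp: weighted_Lp_def)
qed

end
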